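(* If $(A_n)_{n=0}^\infty$ is an Appell sequence with constants $c_k$ defined by $\log f_A(t)=\sum_{k\ge1}c_k\frac{t^k}{k!}$ and $\lambda$ is a partition of $n \geq 1$, then \[ F_\lambda A_\lambda = x \sum_{\mu \lessdot \lambda} F_\mu A_\mu \ +\ \sum_{k=1}^{n} c_k\binom{n -1}{k-1} \sum_{\nu:\ \lambda/\nu \text{ is a rim hook of size } k} (-1)^{\operatorname{ht}(\lambda/\nu)} F_\nu A_\nu, \] where in the first sum $\mu$ ranges over partitions covered by $\lambda$ in Young's lattice (obtained by removing one cell).
   Context: An Appell sequence is a sequence of polynomials $(A_n)_{n\ge0}$ with $A_0=1$ and $A_n'=nA_{n-1}$ for $n\ge1$; it satisfies $\sum_k A_k(x)t^k/k!=e^{xt}f_A(t)$ with $f_A(0)=1$. For a partition $\lambda$ of length $r$, let $(n_1,\dots,n_r)=(\lambda_r,\lambda_{r-1}+1,\dots,\lambda_1+r-1)$ and $A_\lambda=\operatorname{Wr}[A_{n_1},\dots,A_{n_r}]/\Delta(n_1,\dots,n_r)$, where $\operatorname{Wr}$ is the Wronskian and $\Delta$ the Vandermonde determinant $\prod_{i<j}(x_j-x_i)$; $A_\emptyset=1$. $F_\lambda$ is the number of standard Young tableaux of shape $\lambda$. A rim hook of size $k$ is a skew diagram $\lambda/\nu$ with $|\lambda|-|\nu|=k$ that is connected and contains no $2\times2$ square; its height $\operatorname{ht}(\lambda/\nu)$ is one less than the number of rows it occupies. *)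

theory Defs
  imports "HOL-Computational_Algebra.Computational_Algebra" "HOL-Combinatorics.Combinatorics"
begin

section \<open>Appell sequences\<close>

definition appell :: "(nat \<Rightarrow> 'a::field_char_0 poly) \<Rightarrow> bool" where
  "appell A \<longleftrightarrow> A 0 = 1 \<and> (\<forall>n\<ge>1. pderiv (A n) = smult (of_nat n) (A (n - 1)))"

text \<open>The series f_A with sum_k A_k(x) t^k/k! = e^(xt) f_A(t); setting x = 0 gives
  f_A(t) = sum_k A_k(0) t^k / k!.\<close>
definition appell_f :: "(nat \<Rightarrow> 'a::field_char_0 poly) \<Rightarrow> 'a fps" where
  "appell_f A = Abs_fps (\<lambda>k. poly (A k) 0 / fact k)"

text \<open>The exponential generating series sum_{k>=1} c_k t^k/k! of a sequence c.\<close>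
definition egf1 :: "(nat \<Rightarrow> 'a::field_char_0) \<Rightarrow> 'a fps" where
  "egf1 c = Abs_fps (\<lambda>k. if k = 0 then 0 else c k / fact k)"

section \<open>Partitions and Young diagrams\<close>

text \<open>A partition is a weakly decreasing list of positive integers (lambda_1 >= lambda_2 >= ...).\<close>
definition is_partition :: "nat list \<Rightarrow> bool" where
  "is_partition lam \<longleftrightarrow> sorted_wrt (\<ge>) lam \<and> 0 \<notin> set lam"

definition part_size :: "nat list \<Rightarrow> nat" where
  "part_size lam = sum_list lam"

text \<open>Cells (row, column), both 0-based.\<close>
definition cells :: "nat list \<Rightarrow> (nat \<times> nat) set" where
  "cells lam = {(i, j). i < length lam \<and> j < lam ! i}"

text \<open>Standard Young tableaux of shape lam: bijections cells -> {1..|lam|} increasing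
  along rows and down columns.\<close>
definition SYT :: "nat list \<Rightarrow> ((nat \<times> nat) \<Rightarrow> nat) set" where
  "SYT lam = {T. bij_betw T (cells lam) {1..part_size lam} \<and>
      (\<forall>c. c \<notin> cells lam \<longrightarrow> T c = 0) \<and>
      (\<forall>i j. (i, j + 1) \<in> cells lam \<longrightarrow> T (i, j) < T (i, j + 1)) \<and>
      (\<forall>i j. (i + 1, j) \<in> cells lam \<longrightarrow> T (i, j) < T (i + 1, j))}"

definition num_SYT :: "nat list \<Rightarrow> nat" where
  "num_SYT lam = card (SYT lam)"

text \<open>mu is covered by lam in Young's lattice.\<close>
definition covered_by :: "nat list \<Rightarrow> nat list \<Rightarrow> bool" where
  "covered_by mu lam \<longleftrightarrow> is_partition mu \<and> is_partition lam \<and>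
     cells mu \<subseteq> cells lam \<and> part_size mu + 1 = part_size lam"

text \<open>Edge adjacency of cells.\<close>
definition cell_adj :: "nat \<times> nat \<Rightarrow> nat \<times> nat \<Rightarrow> bool" where
  "cell_adj a b \<longleftrightarrow> (fst a = fst b \<and> (snd b = snd a + 1 \<or> snd a = snd b + 1)) \<or>
                     (snd a = snd b \<and> (fst b = fst a + 1 \<or> fst a = fst b + 1))"

definition cells_connected :: "(nat \<times> nat) set \<Rightarrow> bool" where
  "cells_connected S \<longleftrightarrow> S \<noteq> {} \<and>
     (\<forall>a\<in>S. \<forall>b\<in>S. (a, b) \<in> {(x, y). x \<in> S \<and> y \<in> S \<and> cell_adj x y}\<^sup>*)"

definition contains_2x2 :: "(nat \<times> nat) set \<Rightarrow> bool" where
  "contains_2x2 S \<longleftrightarrow> (\<exists>i j. (i, j) \<in> S \<and> (i + 1, j) \<in> S \<and> (i, j + 1) \<in> S \<and> (i + 1, j + 1) \<in> S)"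

text \<open>lam/nu is a rim hook of size k.\<close>
definition rim_hook :: "nat list \<Rightarrow> nat list \<Rightarrow> nat \<Rightarrow> bool" where
  "rim_hook lam nu k \<longleftrightarrow> is_partition lam \<and> is_partition nu \<and>
     cells nu \<subseteq> cells lam \<and> part_size lam - part_size nu = k \<and>
     cells_connected (cells lam - cells nu) \<and> \<not> contains_2x2 (cells lam - cells nu)"

text \<open>Height: number of rows occupied minus one.\<close>
definition rim_height :: "nat list \<Rightarrow> nat list \<Rightarrow> nat" where
  "rim_height lam nu = card (fst ` (cells lam - cells nu)) - 1"

section \<open>Wronskians and A_lambda\<close>

text \<open>Wronskian Wr[f_0,...,f_{r-1}] = det (f_j^{(i)})_{i,j<r}, via the Leibniz formula.\<close>
definition wronskian :: "nat \<Rightarrow> (nat \<Rightarrow> 'a::idom poly) \<Rightarrow> 'a poly" where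
  "wronskian r f = (\<Sum>p\<in>{p. p permutes {..<r}}.
      of_int (sign p) * (\<Prod>i<r. (pderiv ^^ i) (f (p i))))"

text \<open>For lam of length r: n_i = lam_{r-i} + (i-1), i = 1..r; here 0-based:
  n i = lam ! (r - 1 - i) + i for i < r.\<close>
definition shifted_seq :: "nat list \<Rightarrow> nat \<Rightarrow> nat" where
  "shifted_seq lam i = lam ! (length lam - 1 - i) + i"

definition vandermonde :: "nat \<Rightarrow> (nat \<Rightarrow> nat) \<Rightarrow> int" where
  "vandermonde r n = (\<Prod>j<r. \<Prod>i<j. int (n j) - int (n i))"

definition appell_schur :: "(nat \<Rightarrow> 'a::field_char_0 poly) \<Rightarrow> nat list \<Rightarrow> 'a poly" where
  "appell_schur A lam =
     (if lam = [] then 1 else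
       smult (1 / of_int (vandermonde (length lam) (shifted_seq lam)))
         (wronskian (length lam) (\<lambda>i. A (shifted_seq lam i))))"

end

theory Submission
  imports Defs
begin

text \<open>Put h_m = A_m / m! and h_m = 0 for m < 0. Since the i-th derivative of A_m is m! h_{m-i}, the
  Wronskian is a multiple of the Jacobi--Trudi determinant S_lam = det (h_{lam_i - i + j}). For the
  special sequence h_m = 1/m! the same determinant is a Vandermonde determinant of falling factorials
  and counts standard tableaux up to the factor n!; hence F_lam A_lam = n! S_lam.

  The differential equation f' = (log f)' f gives m h_m = sum_k p_k h_{m-k} with p_1 = x + c_1 and
  p_k = c_k / (k-1)!. Applying it to one factor at a time in the Leibniz expansion shows that n S_lam
  is the sum over k of p_k times the determinants in which one number lam_i - i is lowered by k.
  Such a determinant vanishes unless sorting its rows yields S_nu for a rim hook lam/nu of size k,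
  in which case the sorting permutation is a cycle of sign (-1)^ht. For h_m = 1/m! only p_1 = 1
  survives, and the recursion is the branching rule for standard tableaux.\<close>

section \<open>Determinants in Leibniz form\<close>

text \<open>No matrix is ever sorted by hand. A determinant is indexed by an integer sequence u with
  one number per row, so that lowering a number is a function update and swapping rows is
  precomposition with a transposition. \<open>rim_hook_sum\<close> is therefore stated for an
  arbitrary function G of such sequences that changes sign under adjacent swaps, vanishes on
  repeated numbers and vanishes as soon as some number is at most -r. The obstacle is that removing
  a hook may empty rows: every determinant in the recursion keeps r = \<open>length lam\<close>
  rows, and the surplus bottom rows of nu are unitriangular, hence harmless. What the recursion
  needs from h is Newton's identity between complete symmetric functions h_m and power sums p_k,
  together with h_0 = 1 and vanishing at negative indices. This generality is what allows one
  argument to serve both the Appell sequence and the enumeration of tableaux.\<close>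

definition leibniz_det :: "nat \<Rightarrow> (nat \<Rightarrow> nat \<Rightarrow> 'b::comm_ring_1) \<Rightarrow> 'b" where
  "leibniz_det r f = (\<Sum>p | p permutes {..<r}. of_int (sign p) * (\<Prod>i<r. f i (p i)))"

lemma leibniz_det_cong:
  assumes "\<And>i j. i < r \<Longrightarrow> j < r \<Longrightarrow> f i j = g i j"
  shows "leibniz_det r f = leibniz_det r g"
  unfolding leibniz_det_def
proof (intro sum.cong refl)
  fix p assume "p \<in> {p. p permutes {..<r}}"
  then have "p i < r" if "i < r" for i
    using that permutes_in_image[of p "{..<r}" i] by simp
  then show "of_int (sign p) * (\<Prod>i<r. f i (p i)) = of_int (sign p) * (\<Prod>i<r. g i (p i))"
    using assms by (auto intro!: prod.cong arg_cong[where f = "\<lambda>x. _ * x"])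
qed

lemma leibniz_det_transpose: "leibniz_det r (\<lambda>i j. f j i) = leibniz_det r f"
proof -
  have "leibniz_det r f = (\<Sum>p | p permutes {..<r}. of_int (sign (inv p)) * (\<Prod>i<r. f i (inv p i)))"
    unfolding leibniz_det_def by (rule sum_permutations_inverse)
  also have "\<dots> = leibniz_det r (\<lambda>i j. f j i)"
    unfolding leibniz_det_def
  proof (intro sum.cong refl)
    fix p assume "p \<in> {p. p permutes {..<r}}"
    then have p: "p permutes {..<r}" by simp
    then have "sign (inv p) = sign p"
      using sign_inverse permutation_permutes by blast
    moreover have "(\<Prod>i<r. f i (inv p i)) = (\<Prod>i<r. f (p i) i)"
      using prod.permute[OF p, of "\<lambda>i. f i (inv p i)"] by (simp add: comp_def permutes_inverses[OF p])
    ultimately show "of_int (sign (inv p)) * (\<Prod>i<r. f i (inv p i)) = of_int (sign p) * (\<Prod>i<r. f (p i) i)"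
      by simp
  qed
  finally show ?thesis by simp
qed

lemma leibniz_det_permute_rows:
  assumes q: "q permutes {..<r}"
  shows "leibniz_det r (\<lambda>i. f (q i)) = of_int (sign q) * leibniz_det r f"
proof -
  have pq: "permutation q" using q permutation_permutes by blast
  have "leibniz_det r (\<lambda>i. f (q i)) =
      (\<Sum>p | p permutes {..<r}. of_int (sign (p \<circ> q)) * (\<Prod>i<r. f (q i) ((p \<circ> q) i)))"
    unfolding leibniz_det_def by (rule sum_permutations_compose_right[OF q])
  also have "\<dots> = (\<Sum>p | p permutes {..<r}. of_int (sign q) * (of_int (sign p) * (\<Prod>i<r. f i (p i))))"
  proof (intro sum.cong refl)
    fix p assume "p \<in> {p. p permutes {..<r}}"
    then have p: "permutation p" using permutation_permutes by blast
    have "(\<Prod>i<r. f (q i) ((p \<circ> q) i)) = (\<Prod>i<r. f i (p i))"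
      using prod.permute[OF q, of "\<lambda>i. f i (p i)"] by (simp add: comp_def)
    then show "of_int (sign (p \<circ> q)) * (\<Prod>i<r. f (q i) ((p \<circ> q) i)) =
        of_int (sign q) * (of_int (sign p) * (\<Prod>i<r. f i (p i)))"
      by (simp add: sign_compose[OF p pq])
  qed
  finally show ?thesis
    by (simp add: leibniz_det_def sum_distrib_left)
qed

lemma leibniz_det_scale_rows:
  "leibniz_det r (\<lambda>i j. c i * f i j) = (\<Prod>i<r. c i) * leibniz_det r f"
  unfolding leibniz_det_def by (simp add: prod.distrib sum_distrib_left mult_ac)

lemma leibniz_det_swap_rows:
  assumes "a < r" "b < r" "a \<noteq> b"
  shows "leibniz_det r (\<lambda>i. f (transpose a b i)) = - leibniz_det r f"
  using leibniz_det_permute_rows[OF permutes_swap_id[of a "{..<r}" b], of f] assms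
  by (simp add: sign_swap_id)

text \<open>Swapping the two equal rows gives det = -det; the class \<open>ring_char_0\<close> lets
  the factor 2 be cancelled.\<close>

lemma leibniz_det_identical_rows:
  fixes f :: "nat \<Rightarrow> nat \<Rightarrow> 'b::{idom, ring_char_0}"
  assumes "a < r" "b < r" "a \<noteq> b" "\<And>j. j < r \<Longrightarrow> f a j = f b j"
  shows "leibniz_det r f = 0"
proof -
  have "leibniz_det r f = leibniz_det r (\<lambda>i. f (transpose a b i))"
    using assms(4) by (intro leibniz_det_cong) (auto simp: transpose_def)
  also have "\<dots> = - leibniz_det r f"
    by (rule leibniz_det_swap_rows) (use assms in auto)
  finally have "2 * leibniz_det r f = 0" by simp
  then show ?thesis by simp
qed

lemma leibniz_det_zero_row:
  assumes "a < r" "\<And>j. j < r \<Longrightarrow> f a j = 0"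
  shows "leibniz_det r f = 0"
  unfolding leibniz_det_def
proof (intro sum.neutral ballI)
  fix p assume "p \<in> {p. p permutes {..<r}}"
  then have "p a < r" using assms(1) permutes_in_image[of p "{..<r}" a] by simp
  then have "(\<Prod>i<r. f i (p i)) = 0"
    using assms by (intro prod_zero) auto
  then show "of_int (sign p) * (\<Prod>i<r. f i (p i)) = 0" by simp
qed

text \<open>The sign of the reversal occurs once for the rows and once for the columns. This
  mediates between the decreasing order of a partition and the increasing order of
  \<open>shifted_seq\<close>.\<close>

lemma leibniz_det_reverse:
  "leibniz_det r (\<lambda>i j. f (r - 1 - i) (r - 1 - j)) = leibniz_det r f"
proof -
  define v where "v i = (if i < r then r - 1 - i else i)" for i
  have v: "v permutes {..<r}"
    unfolding permutes_def
  proof (intro conjI allI impI)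
    fix y
    show "\<exists>!x. v x = y"
      by (rule ex1I[of _ "v y"]) (auto simp: v_def split: if_splits)
  qed (auto simp: v_def)
  have "leibniz_det r (\<lambda>i j. f (r - 1 - i) (r - 1 - j)) = leibniz_det r (\<lambda>i j. f (v i) (v j))"
    by (rule leibniz_det_cong) (simp add: v_def)
  also have "\<dots> = of_int (sign v) * leibniz_det r (\<lambda>i j. f i (v j))"
    by (rule leibniz_det_permute_rows[OF v, of "\<lambda>i j. f i (v j)"])
  also have "leibniz_det r (\<lambda>i j. f i (v j)) = leibniz_det r (\<lambda>i j. f j (v i))"
    by (rule leibniz_det_transpose[symmetric])
  also have "\<dots> = of_int (sign v) * leibniz_det r (\<lambda>i j. f j i)"
    by (rule leibniz_det_permute_rows[OF v, of "\<lambda>i j. f j i"])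
  also have "leibniz_det r (\<lambda>i j. f j i) = leibniz_det r f"
    by (rule leibniz_det_transpose)
  also have "of_int (sign v) * (of_int (sign v) * leibniz_det r f) = leibniz_det r f"
    by (simp flip: mult.assoc of_int_mult)
  finally show ?thesis .
qed

text \<open>Permutations of r + 1 points that fix r are those of r points, so this is Laplace
  expansion when only the corner cofactor survives. It serves both a unit last row and the
  extraction of a leading coefficient.\<close>

lemma sum_permutations_fixing_last:
  assumes "\<And>p. p permutes {..<Suc r} \<Longrightarrow> p r \<noteq> r \<Longrightarrow> g p = 0"
  shows "sum g {p. p permutes {..<Suc r}} = sum g {p. p permutes {..<r}}"
proof (rule sum.mono_neutral_right)
  show "finite {p. p permutes {..<Suc r}}" by (simp add: finite_permutations)
  show "{p. p permutes {..<r}} \<subseteq> {p. p permutes {..<Suc r}}"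
    using permutes_subset[of _ "{..<r}" "{..<Suc r}"] by auto
  show "\<forall>p\<in>{p. p permutes {..<Suc r}} - {p. p permutes {..<r}}. g p = 0"
  proof
    fix p assume p: "p \<in> {p. p permutes {..<Suc r}} - {p. p permutes {..<r}}"
    have "p r \<noteq> r"
    proof
      assume "p r = r"
      then have "p permutes {..<r}"
        using p permutes_superset[of p "{..<Suc r}" "{..<r}"] by (auto simp: less_Suc_eq)
      with p show False by simp
    qed
    with p assms show "g p = 0" by simp
  qed
qed

lemma leibniz_det_last_row_unit:
  assumes "\<And>j. j < r \<Longrightarrow> f r j = 0" "f r r = 1"
  shows "leibniz_det (Suc r) f = leibniz_det r f"
proof -
  have "leibniz_det (Suc r) f = (\<Sum>p | p permutes {..<r}. of_int (sign p) * (\<Prod>i<Suc r. f i (p i)))"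
    unfolding leibniz_det_def
  proof (rule sum_permutations_fixing_last)
    fix p assume p: "p permutes {..<Suc r}" "p r \<noteq> r"
    then have "p r < r" using permutes_in_image[of p "{..<Suc r}" r] by simp
    then show "of_int (sign p) * (\<Prod>i<Suc r. f i (p i)) = 0" using assms(1) by simp
  qed
  also have "\<dots> = leibniz_det r f"
    unfolding leibniz_det_def
  proof (intro sum.cong refl)
    fix p assume "p \<in> {p. p permutes {..<r}}"
    then have "p r = r" by (simp add: permutes_def)
    then show "of_int (sign p) * (\<Prod>i<Suc r. f i (p i)) = of_int (sign p) * (\<Prod>i<r. f i (p i))"
      using assms(2) by simp
  qed
  finally show ?thesis .
qed

section \<open>The Vandermonde determinant in falling factorials\<close>

definition falling :: "'b::comm_ring_1 \<Rightarrow> nat \<Rightarrow> 'b" where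
  "falling x i = (\<Prod>l<i. x - of_nat l)"

lemma poly_falling: "poly (falling [:0, 1:] i) x = falling (x::'b::comm_ring_1) i"
  by (simp add: falling_def poly_prod of_nat_poly)

lemma falling_poly_monic:
  "degree (falling [:0, 1::'b::idom:] i) = i \<and> coeff (falling [:0, 1::'b:] i) i = 1"
proof (induction i)
  case (Suc i)
  let ?p = "falling [:0, 1::'b:] i"
  have p: "falling [:0, 1::'b:] (Suc i) = ?p * [:- of_nat i, 1:]"
    by (simp add: falling_def of_nat_poly)
  have "?p \<noteq> 0" using Suc by auto
  then have "degree (?p * [:- of_nat i, 1:]) = Suc i"
    using Suc by (subst degree_mult_eq) auto
  moreover from this have "coeff (?p * [:- of_nat i, 1:]) (Suc i) = 1"
    using Suc lead_coeff_mult[of ?p "[:- of_nat i, 1:]"] by simp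
  ultimately show ?case using p by simp
qed (simp add: falling_def)

lemma prod_const_poly: "(\<Prod>i\<in>A. [:f i:]) = [:prod f A:]"
  for f :: "'c \<Rightarrow> 'b::comm_ring_1"
  by (induction A rule: infinite_finite_induct) (simp_all add: one_pCons)

text \<open>The last node is replaced by a polynomial variable. The resulting Q has degree at most
  r, its r-th coefficient is the smaller determinant V, and it vanishes at the other nodes, where
  two rows coincide; so Q is V times the product of the X - x_i.\<close>

lemma vandermonde_falling:
  fixes x :: "nat \<Rightarrow> 'b::{idom, ring_char_0}"
  assumes "inj_on x {..<r}"
  shows "leibniz_det r (\<lambda>j i. falling (x j) i) = (\<Prod>j<r. \<Prod>i<j. x j - x i)"
  using assms
proof (induction r)
  case 0
  then show ?case by (simp add: leibniz_det_def)
next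
  case (Suc r)
  let ?X = "[:0, 1::'b:]"
  define y where "y j = (if j < r then [:x j:] else ?X)" for j
  define Q where "Q = leibniz_det (Suc r) (\<lambda>i j. falling (y j) i)"
  define V where "V = leibniz_det r (\<lambda>j i. falling (x j) i)"
  define R where "R = smult V (\<Prod>i<r. [:- x i, 1:])"
  have y_const: "falling (y j) i = [:falling (x j) i:]" if "j < r" for i j
    using that
    by (induction i) (simp_all add: y_def falling_def of_nat_poly)
  \<comment> \<open>Only the factor with index l = \<open>inv p r\<close> contains the variable, so
    each Leibniz term is a constant times a monic polynomial of degree l, and degree r occurs only
    for permutations fixing r.\<close>
  have term_form: "\<exists>k l. l \<le> r \<and> (l = r \<longleftrightarrow> p r = r) \<and>
      (\<Prod>i<Suc r. falling (y (p i)) i) = smult k (falling ?X l) \<and>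
      (l = r \<longrightarrow> k = (\<Prod>i<r. falling (x (p i)) i))"
    if p: "p permutes {..<Suc r}" for p
  proof -
    define l where "l = inv p r"
    have l: "l < Suc r" "p l = r"
      using permutes_in_image[OF permutes_inv[OF p], of r] permutes_inverses(1)[OF p]
      by (auto simp: l_def)
    have lt: "p i < r" if "i \<in> {..<Suc r} - {l}" for i
    proof -
      have "p i < Suc r" using that permutes_in_image[OF p, of i] by auto
      moreover have "p i \<noteq> r" using that l(2) permutes_inj[OF p] by (auto simp: inj_def)
      ultimately show ?thesis by simp
    qed
    have "(\<Prod>i<Suc r. falling (y (p i)) i) = falling (y (p l)) l * (\<Prod>i\<in>{..<Suc r} - {l}. falling (y (p i)) i)"
      using l(1) by (intro prod.remove) auto
    also have "(\<Prod>i\<in>{..<Suc r} - {l}. falling (y (p i)) i) = (\<Prod>i\<in>{..<Suc r} - {l}. [:falling (x (p i)) i:])"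
      using lt y_const by (intro prod.cong) auto
    also have "\<dots> = [:\<Prod>i\<in>{..<Suc r} - {l}. falling (x (p i)) i:]"
      by (rule prod_const_poly)
    finally have "(\<Prod>i<Suc r. falling (y (p i)) i) = smult (\<Prod>i\<in>{..<Suc r} - {l}. falling (x (p i)) i) (falling ?X l)"
      using l(2) by (simp add: y_def)
    moreover have "l = r \<longleftrightarrow> p r = r"
      using l(2) permutes_inj[OF p] by (auto simp: inj_def)
    moreover have "{..<Suc r} - {l} = {..<r}" if "l = r" using that by auto
    ultimately show ?thesis using l(1) by (intro exI[of _ "(\<Prod>i\<in>{..<Suc r} - {l}. falling (x (p i)) i)"] exI[of _ l]) auto
  qed
  have deg: "degree Q \<le> r"
    unfolding Q_def leibniz_det_def
  proof (intro degree_sum_le)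
    fix p assume "p \<in> {p. p permutes {..<Suc r}}"
    then obtain k l where kl: "l \<le> r" "(\<Prod>i<Suc r. falling (y (p i)) i) = smult k (falling ?X l)"
      using term_form by blast
    show "degree (of_int (sign p) * (\<Prod>i<Suc r. falling (y (p i)) i)) \<le> r"
      using kl falling_poly_monic[of l, where 'b = 'b]
      by (auto simp: of_int_poly simp del: prod.lessThan_Suc intro!: degree_smult_le[THEN order_trans])
  qed (simp add: finite_permutations)
  have "coeff Q r = (\<Sum>p | p permutes {..<Suc r}.
      of_int (sign p) * coeff (\<Prod>i<Suc r. falling (y (p i)) i) r)"
    unfolding Q_def leibniz_det_def by (simp add: coeff_sum of_int_poly del: prod.lessThan_Suc)
  also have "\<dots> = (\<Sum>p | p permutes {..<r}.
      of_int (sign p) * coeff (\<Prod>i<Suc r. falling (y (p i)) i) r)"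
  proof (rule sum_permutations_fixing_last)
    fix p assume "p permutes {..<Suc r}" "p r \<noteq> r"
    then obtain k l where "l < r" "(\<Prod>i<Suc r. falling (y (p i)) i) = smult k (falling ?X l)"
      using term_form[of p] by (auto simp del: prod.lessThan_Suc simp: order.order_iff_strict)
    then show "of_int (sign p) * coeff (\<Prod>i<Suc r. falling (y (p i)) i) r = 0"
      using falling_poly_monic[of l, where 'b = 'b]
      by (simp add: coeff_eq_0 del: prod.lessThan_Suc)
  qed
  also have "\<dots> = leibniz_det r (\<lambda>i j. falling (x j) i)"
    unfolding leibniz_det_def
  proof (intro sum.cong refl)
    fix p assume "p \<in> {p. p permutes {..<r}}"
    then have "p r = r" "p permutes {..<Suc r}"
      using permutes_subset[of _ "{..<r}" "{..<Suc r}"] by (auto simp: permutes_def)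
    then have "(\<Prod>i<Suc r. falling (y (p i)) i) = smult (\<Prod>i<r. falling (x (p i)) i) (falling ?X r)"
      using term_form[of p] by (auto simp del: prod.lessThan_Suc)
    then show "of_int (sign p) * coeff (\<Prod>i<Suc r. falling (y (p i)) i) r =
        of_int (sign p) * (\<Prod>i<r. falling (x (p i)) i)"
      using falling_poly_monic[of r, where 'b = 'b] by (simp del: prod.lessThan_Suc)
  qed
  also have "\<dots> = V" unfolding V_def by (rule leibniz_det_transpose)
  finally have coeff_Q: "coeff Q r = V" .
  have deg_R: "degree (\<Prod>i<r. [:- x i, 1:]) = r" by (subst degree_prod_eq_sum_degree) auto
  have "coeff (\<Prod>i<r. [:- x i, 1:]) r = 1"
    using lead_coeff_prod[of "\<lambda>i. [:- x i, 1:]" "{..<r}"] unfolding deg_R by simp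
  then have coeff_R: "coeff R r = V" unfolding R_def by simp
  have eval: "poly Q z = leibniz_det (Suc r) (\<lambda>j i. falling ((x(r := z)) j) i)" for z
  proof -
    have "poly Q z = leibniz_det (Suc r) (\<lambda>i j. poly (falling (y j) i) z)"
      unfolding Q_def leibniz_det_def by (simp add: poly_sum poly_prod of_int_poly)
    also have "\<dots> = leibniz_det (Suc r) (\<lambda>i j. falling ((x(r := z)) j) i)"
      by (rule leibniz_det_cong) (use y_const in \<open>auto simp: less_Suc_eq y_def poly_falling\<close>)
    finally show ?thesis by (subst (asm) leibniz_det_transpose[symmetric]) simp
  qed
  have "Q = R"
  \<comment> \<open>Injectivity of x yields r distinct points of agreement, which together with the
    common r-th coefficient determine a polynomial of degree at most r.\<close>
  proof (rule poly_eqI_degree_lead_coeff[of _ r _ "x ` {..<r}"])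
    show "coeff Q r = coeff R r" using coeff_Q coeff_R by simp
    show "r \<le> card (x ` {..<r})"
      using Suc.prems by (subst card_image) (auto simp: inj_on_def)
    show "degree Q \<le> r" by (rule deg)
    show "degree R \<le> r" unfolding R_def using deg_R degree_smult_le by metis
    fix z assume "z \<in> x ` {..<r}"
    then obtain j where j: "j < r" "z = x j" by auto
    have "poly Q z = 0" unfolding eval
      by (rule leibniz_det_identical_rows[of j _ r]) (use j in auto)
    moreover have "poly R z = 0" using j by (auto simp: R_def poly_prod)
    ultimately show "poly Q z = poly R z" by simp
  qed
  then have "leibniz_det (Suc r) (\<lambda>j i. falling ((x(r := x r)) j) i) = poly R (x r)"
    using eval by metis
  also have "\<dots> = V * (\<Prod>i<r. x r - x i)" by (simp add: R_def poly_prod)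
  also have "V = (\<Prod>j<r. \<Prod>i<j. x j - x i)"
    unfolding V_def by (rule Suc.IH) (use Suc.prems in \<open>auto simp: inj_on_def\<close>)
  finally show ?case by simp
qed

section \<open>Partitions, beads and rim hooks\<close>

text \<open>Rows past the end have length 0, so partitions of different lengths can be compared row
  by row.\<close>

abbreviation row :: "nat list \<Rightarrow> nat \<Rightarrow> nat" where
  "row \<equiv> nth_default 0"

lemma mem_cells_iff: "(i, j) \<in> cells lam \<longleftrightarrow> j < row lam i"
  by (simp add: cells_def nth_default_def)

lemma row_antimono:
  assumes "is_partition lam" "i \<le> j"
  shows "row lam j \<le> row lam i"
  using assms sorted_wrt_nth_less[of "(\<ge>)" lam i j]
  by (cases "i = j") (auto simp: is_partition_def nth_default_def)

lemma row_pos_iff: "is_partition lam \<Longrightarrow> 0 < row lam i \<longleftrightarrow> i < length lam"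
  by (auto simp: is_partition_def nth_default_def) (metis gr0I nth_mem)

lemma cells_subset_iff: "cells nu \<subseteq> cells lam \<longleftrightarrow> (\<forall>i. row nu i \<le> row lam i)"
proof
  assume sub: "cells nu \<subseteq> cells lam"
  show "\<forall>i. row nu i \<le> row lam i"
  proof (rule allI, rule ccontr)
    fix i assume "\<not> row nu i \<le> row lam i"
    then have "(i, row lam i) \<in> cells nu" by (simp add: mem_cells_iff)
    then show False using sub mem_cells_iff by blast
  qed
next
  assume le: "\<forall>i. row nu i \<le> row lam i"
  show "cells nu \<subseteq> cells lam"
  proof
    fix c assume "c \<in> cells nu"
    then show "c \<in> cells lam"
      using le by (cases c) (auto simp: mem_cells_iff intro: less_le_trans)
  qed
qed

lemma partition_eqI:
  assumes "is_partition lam" "is_partition mu" "\<And>i. row lam i = row mu i"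
  shows "lam = mu"
proof (rule nth_equalityI)
  have "i < length lam \<longleftrightarrow> i < length mu" for i
    using assms row_pos_iff by metis
  then show len: "length lam = length mu" by (metis linorder_neqE_nat less_irrefl)
  fix i assume "i < length lam"
  then show "lam ! i = mu ! i" using assms(3)[of i] len by (simp add: nth_default_def)
qed

lemma length_le_iff: "is_partition lam \<Longrightarrow> length lam \<le> r \<longleftrightarrow> row lam r = 0"
  using row_pos_iff[of lam r] by auto

lemma length_le_of_cells_subset:
  assumes "is_partition nu" "is_partition lam" "cells nu \<subseteq> cells lam"
  shows "length nu \<le> length lam"
  using assms by (simp add: length_le_iff cells_subset_iff nth_default_def) (metis le_zero_eq less_irrefl)

text \<open>The list of values is cut at the first zero, since a partition has no zero
  entries.\<close>

lemma partition_with_rows: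
  fixes g :: "nat \<Rightarrow> nat"
  assumes "\<And>i. g (Suc i) \<le> g i" "g r = 0"
  obtains nu where "is_partition nu" "row nu = g"
proof
  define l where "l = (LEAST i. g i = 0)"
  have anti: "g j \<le> g i" if "i \<le> j" for i j
    using assms(1) that by (rule lift_Suc_antimono_le)
  have gl: "g l = 0" unfolding l_def using assms(2) by (rule LeastI)
  have pos: "0 < g i" if "i < l" for i
    using not_less_Least[of i "\<lambda>i. g i = 0"] that by (simp add: l_def)
  show "is_partition (map g [0..<l])"
    unfolding is_partition_def
    by (auto simp: sorted_wrt_map sorted_wrt_iff_nth_less intro!: anti)
       (metis pos less_irrefl)
  show "row (map g [0..<l]) = g"
  proof
    fix i
    show "row (map g [0..<l]) i = g i"
      using anti[of l i] gl by (simp add: nth_default_def)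
  qed
qed

lemma part_size_eq_sum_rows:
  assumes "length lam \<le> r"
  shows "part_size lam = (\<Sum>i<r. row lam i)"
proof -
  have "part_size lam = (\<Sum>i<length lam. row lam i)"
    unfolding part_size_def by (simp add: sum_list_sum_nth nth_default_def atLeast0LessThan)
  also have "\<dots> = (\<Sum>i<r. row lam i)"
    using assms by (intro sum.mono_neutral_left) (auto simp: nth_default_def)
  finally show ?thesis .
qed

text \<open>The Maya diagram (shifted beta-set) of the partition, continued past its length by the
  values -i; hence the integers.\<close>

definition bead :: "nat list \<Rightarrow> nat \<Rightarrow> int" where
  "bead lam i = int (row lam i) - int i"

lemma bead_strict_antimono:
  assumes "is_partition lam" "i < j"
  shows "bead lam j < bead lam i"
  using row_antimono[of lam i j] assms by (simp add: bead_def)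

lemma bead_eq_iff: "is_partition lam \<Longrightarrow> bead lam i = bead lam j \<longleftrightarrow> i = j"
  using bead_strict_antimono by (metis less_irrefl linorder_neqE_nat)

lemma bead_inject:
  assumes "is_partition lam" "is_partition mu" "bead lam = bead mu"
  shows "lam = mu"
  using assms(1,2)
proof (rule partition_eqI)
  fix i
  show "row lam i = row mu i" using fun_cong[OF assms(3), of i] by (simp add: bead_def)
qed

text \<open>Replaces entry a by v and then moves v down to position b past the entries in between:
  the effect of re-sorting a decreasing sequence after one entry has been lowered.\<close>

definition slide :: "(nat \<Rightarrow> 'b) \<Rightarrow> nat \<Rightarrow> nat \<Rightarrow> 'b \<Rightarrow> nat \<Rightarrow> 'b" where
  "slide f a b v i = (if a \<le> i \<and> i < b then f (Suc i) else if i = b then v else f i)"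

lemma slide_same: "slide f a a v = f(a := v)"
  by (auto simp: slide_def)

text \<open>Moving v one place further is one adjacent transposition, so the sorting cycle is a
  product of b - a of them.\<close>

lemma slide_Suc:
  assumes "a \<le> b"
  shows "slide f a (Suc b) v = slide f a b v \<circ> transpose b (Suc b)"
  using assms by (auto simp: slide_def transpose_def fun_eq_iff)

lemma sum_slide:
  fixes f :: "nat \<Rightarrow> 'b::ab_group_add"
  assumes "a \<le> b" "b < r"
  shows "(\<Sum>i<r. slide f a b v i) = (\<Sum>i<r. f i) - f a + v"
  using assms
proof (induction b rule: dec_induct)
  case base
  have "(\<Sum>i\<in>{..<r} - {a}. (f(a := v)) i) = (\<Sum>i\<in>{..<r} - {a}. f i)"
    by (rule sum.cong) auto
  with base show ?case by (simp add: slide_same sum.remove[of "{..<r}" a] del: fun_upd_apply) simp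
next
  case (step b)
  have "transpose b (Suc b) permutes {..<r}"
    using step.prems by (intro permutes_swap_id) auto
  then have "(\<Sum>i<r. slide f a (Suc b) v i) = (\<Sum>i<r. slide f a b v i)"
    using sum.permute[of "transpose b (Suc b)" "{..<r}" "slide f a b v"] slide_Suc[OF step.hyps(1), of f v]
    by (simp add: comp_def)
  with step show ?case by simp
qed

section \<open>Rim hooks as border strips and as bead moves\<close>

text \<open>A rim hook occupying exactly the rows a to b: consecutive rows overlap in a single column,
  since fewer would disconnect the skew diagram and more would create a 2x2 square.\<close>

definition border_strip :: "nat list \<Rightarrow> nat list \<Rightarrow> nat \<Rightarrow> nat \<Rightarrow> bool" where
  "border_strip lam nu a b \<longleftrightarrow> a \<le> b \<and>
     (\<forall>i. i < a \<or> b < i \<longrightarrow> row nu i = row lam i) \<and>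
     (\<forall>i. a \<le> i \<and> i < b \<longrightarrow> Suc (row nu i) = row lam (Suc i)) \<and>
     row nu b < row lam b"

lemma border_strip_row_less_iff:
  assumes "is_partition lam" "border_strip lam nu a b"
  shows "row nu i < row lam i \<longleftrightarrow> i \<in> {a..b}"
proof -
  consider "i < a \<or> b < i" | "a \<le> i \<and> i < b" | "i = b"
    by linarith
  then show ?thesis
  proof cases
    case 2
    then have "Suc (row nu i) = row lam (Suc i)" using assms(2) by (simp add: border_strip_def)
    then show ?thesis using row_antimono[OF assms(1), of i "Suc i"] 2 by auto
  qed (use assms(2) in \<open>auto simp: border_strip_def\<close>)
qed

lemma border_strip_row_le:
  assumes "is_partition lam" "border_strip lam nu a b"
  shows "row nu i \<le> row lam i"
proof (cases "i \<in> {a..b}")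
  case True
  then show ?thesis using border_strip_row_less_iff[OF assms, of i] by simp
next
  case False
  then show ?thesis using assms(2) by (auto simp: border_strip_def)
qed

lemma rim_height_border_strip:
  assumes "is_partition lam" "border_strip lam nu a b"
  shows "rim_height lam nu = b - a"
proof -
  have "fst ` (cells lam - cells nu) = {i. row nu i < row lam i}"
  proof (intro equalityI subsetI)
    fix i assume "i \<in> {i. row nu i < row lam i}"
    then have "(i, row nu i) \<in> cells lam - cells nu" by (simp add: mem_cells_iff)
    then show "i \<in> fst ` (cells lam - cells nu)" by force
  qed (auto simp: mem_cells_iff)
  also have "\<dots> = {a..b}" using border_strip_row_less_iff[OF assms] by (simp add: set_eq_iff)
  finally show ?thesis by (simp add: rim_height_def)
qed

lemma border_strip_no_2x2:
  assumes "is_partition lam" "border_strip lam nu a b"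
  shows "\<not> contains_2x2 (cells lam - cells nu)"
proof
  assume "contains_2x2 (cells lam - cells nu)"
  then obtain i j where ij: "row nu i \<le> j" "j < row lam i" "Suc j < row lam (Suc i)" "row nu (Suc i) \<le> j"
    unfolding contains_2x2_def Diff_iff mem_cells_iff by (metis Suc_eq_plus1 not_le)
  then have "i \<in> {a..b}" "Suc i \<in> {a..b}"
    using border_strip_row_less_iff[OF assms, symmetric] by auto
  then have "Suc (row nu i) = row lam (Suc i)" using assms(2) by (simp add: border_strip_def)
  with ij show False by simp
qed

text \<open>Each strip cell is joined leftwards to the first strip cell of its row. The cell below
  that one is the last strip cell of the next row, so every cell reaches the first strip cell of row
  b.\<close>

lemma border_strip_connected:
  assumes lam: "is_partition lam" and nu: "is_partition nu" and strip: "border_strip lam nu a b"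
  shows "cells_connected (cells lam - cells nu)"
proof -
  define S where "S = cells lam - cells nu"
  define R where "R = {(x, y). x \<in> S \<and> y \<in> S \<and> cell_adj x y}"
  have mem: "(i, j) \<in> S \<longleftrightarrow> row nu i \<le> j \<and> j < row lam i" for i j
    by (auto simp: S_def mem_cells_iff)
  have "sym (R\<^sup>*)"
    by (rule sym_rtrancl) (auto simp: sym_def R_def cell_adj_def)
  have left: "((i, j), (i, row nu i)) \<in> R\<^sup>*" if "(i, j) \<in> S" for i j
  proof -
    have "row nu i \<le> j" "j < row lam i" using that mem by auto
    then show ?thesis
    proof (induction j rule: dec_induct)
      case (step j)
      then have "((i, Suc j), (i, j)) \<in> R" by (simp add: R_def mem cell_adj_def)
      with step show ?case by (meson Suc_lessD converse_rtrancl_into_rtrancl)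
    qed simp
  qed
  have down: "((i, row nu i), (b, row nu b)) \<in> R\<^sup>*" if "a \<le> i" "i \<le> b" for i
    using that(2,1)
  proof (induction i rule: inc_induct)
    case (step i)
    have "Suc (row nu i) = row lam (Suc i)" using step strip by (simp add: border_strip_def)
    moreover have "row nu (Suc i) \<le> row nu i" "row lam (Suc i) \<le> row lam i"
      using row_antimono lam nu by auto
    ultimately have "((i, row nu i), (Suc i, row nu i)) \<in> R" "(Suc i, row nu i) \<in> S"
      by (auto simp: R_def mem cell_adj_def)
    with left[of "Suc i" "row nu i"] step show ?case
      by (meson converse_rtrancl_into_rtrancl le_SucI rtrancl_trans)
  qed simp
  have to_end: "(c, (b, row nu b)) \<in> R\<^sup>*" if "c \<in> S" for c
  proof (cases c)
    case (Pair i j)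
    then have "i \<in> {a..b}"
      using that border_strip_row_less_iff[OF lam strip, of i] mem by auto
    then show ?thesis using left[of i j] down[of i] that Pair by (auto intro: rtrancl_trans)
  qed
  have "(b, row nu b) \<in> S" using strip by (simp add: mem border_strip_def)
  moreover have "(c, d) \<in> R\<^sup>*" if "c \<in> S" "d \<in> S" for c d
    using to_end[OF that(1)] to_end[OF that(2)] \<open>sym (R\<^sup>*)\<close> by (meson rtrancl_trans symD)
  ultimately show ?thesis
    unfolding cells_connected_def R_def S_def by blast
qed

text \<open>An adjacency step changes the row by at most one, so a path leading below row i must at
  some point step vertically from row i to row i + 1.\<close>

lemma connected_crossing:
  assumes "cells_connected S" "x \<in> S" "fst x \<le> i" "y \<in> S" "i < fst y"
  shows "\<exists>j. (i, j) \<in> S \<and> (Suc i, j) \<in> S"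
proof -
  have "(x, y) \<in> {(x, y). x \<in> S \<and> y \<in> S \<and> cell_adj x y}\<^sup>*"
    using assms by (auto simp: cells_connected_def)
  then show ?thesis
    using assms(5,3)
  proof (induction rule: rtrancl_induct)
    case (step y z)
    show ?case
    proof (cases "i < fst y")
      case False
      with step have "fst y = i" "fst z = Suc i" "snd y = snd z" "y \<in> S" "z \<in> S"
        by (auto simp: cell_adj_def)
      then show ?thesis by (metis prod.collapse)
    qed (use step in auto)
  qed simp
qed

text \<open>Connectedness also forces the occupied rows to form an interval, so their minimum and
  maximum serve as a and b.\<close>

lemma connected_skew_border_strip:
  assumes lam: "is_partition lam" and nu: "is_partition nu" and sub: "cells nu \<subseteq> cells lam"
    and conn: "cells_connected (cells lam - cells nu)"
    and no2: "\<not> contains_2x2 (cells lam - cells nu)"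
  obtains a b where "border_strip lam nu a b"
proof -
  define I where "I = {i. row nu i < row lam i}"
  have le: "row nu i \<le> row lam i" for i using sub cells_subset_iff by blast
  have fin: "finite I"
    by (rule finite_subset[of _ "{..<length lam}"]) (auto simp: I_def nth_default_def split: if_splits)
  obtain i0 j0 where "(i0, j0) \<in> cells lam - cells nu"
    using conn by (auto simp: cells_connected_def)
  then have "i0 \<in> I" by (auto simp: I_def mem_cells_iff)
  then have ne: "I \<noteq> {}" by auto
  have in_I: "(i, row nu i) \<in> cells lam - cells nu" if "i \<in> I" for i
    using that by (simp add: I_def mem_cells_iff)
  have "border_strip lam nu (Min I) (Max I)"
    unfolding border_strip_def
  proof (intro conjI allI impI)
    show "Min I \<le> Max I" using fin ne by simp
    show "row nu (Max I) < row lam (Max I)" using Max_in[OF fin ne] by (simp add: I_def)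
  next
    fix i assume "i < Min I \<or> Max I < i"
    then have "i \<notin> I" by (auto dest: Min_le[OF fin] Max_ge[OF fin])
    then show "row nu i = row lam i" using le[of i] by (simp add: I_def)
  next
    fix i assume i: "Min I \<le> i \<and> i < Max I"
    obtain j where j: "(i, j) \<in> cells lam - cells nu" "(Suc i, j) \<in> cells lam - cells nu"
      using connected_crossing[OF conn in_I[OF Min_in[OF fin ne]] _ in_I[OF Max_in[OF fin ne]], of i] i
      by auto
    then have "Suc (row nu i) \<le> row lam (Suc i)" by (auto simp: mem_cells_iff)
    moreover have "\<not> Suc (row nu i) < row lam (Suc i)"
    proof
      assume "Suc (row nu i) < row lam (Suc i)"
      moreover have "row nu (Suc i) \<le> row nu i" "row lam (Suc i) \<le> row lam i"
        using row_antimono lam nu by auto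
      \<comment> \<open>The square has its upper left corner at the first skew cell of row
        i.\<close>
      ultimately have "contains_2x2 (cells lam - cells nu)"
        unfolding contains_2x2_def
        by (intro exI[of _ i] exI[of _ "row nu i"]) (auto simp: mem_cells_iff)
      with no2 show False by simp
    qed
    ultimately show "Suc (row nu i) = row lam (Suc i)" by simp
  qed
  then show ?thesis by (rule that)
qed

text \<open>In beads the overlap condition \<open>Suc (row nu i) = row lam (Suc i)\<close> reads
  \<open>bead nu i = bead lam (Suc i)\<close>: removing the strip takes out bead a and reinserts a
  lower value at position b.\<close>

lemma border_strip_iff_bead:
  assumes "is_partition lam"  "is_partition nu"
  shows "border_strip lam nu a b \<longleftrightarrow>
    a \<le> b \<and> bead nu = slide (bead lam) a b (bead nu b) \<and> bead nu b < bead lam b"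
  unfolding border_strip_def fun_eq_iff slide_def bead_def
  by (auto split: if_splits)

text \<open>The first r beads sum to the size minus a constant depending on r only, so the number of
  removed cells is the drop of the moved bead.\<close>

lemma border_strip_sizes:
  assumes lam: "is_partition lam" and nu: "is_partition nu" and strip: "border_strip lam nu a b"
  shows "cells nu \<subseteq> cells lam" "b < length lam" "part_size nu \<le> part_size lam"
    "int (part_size lam) - int (part_size nu) = bead lam a - bead nu b"
proof -
  show sub: "cells nu \<subseteq> cells lam"
    using border_strip_row_le[OF lam strip] by (simp add: cells_subset_iff)
  show b: "b < length lam"
    using strip row_pos_iff[OF lam, of b] by (simp add: border_strip_def)
  define r where "r = length lam"
  have lengths: "length lam \<le> r" "length nu \<le> r"
    using length_le_of_cells_subset[OF nu lam sub] by (auto simp: r_def)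
  show "part_size nu \<le> part_size lam"
    unfolding part_size_eq_sum_rows[OF lengths(1)] part_size_eq_sum_rows[OF lengths(2)]
    by (intro sum_mono border_strip_row_le[OF lam strip])
  have "a \<le> b" "bead nu = slide (bead lam) a b (bead nu b)"
    using strip border_strip_iff_bead[OF lam nu] by auto
  then have "(\<Sum>i<r. bead nu i) = (\<Sum>i<r. bead lam i) - bead lam a + bead nu b"
    using sum_slide[of a b r "bead lam" "bead nu b"] b by (simp add: r_def)
  then show "int (part_size lam) - int (part_size nu) = bead lam a - bead nu b"
    unfolding part_size_eq_sum_rows[OF lengths(1)] part_size_eq_sum_rows[OF lengths(2)]
    by (simp add: bead_def sum_subtractf)
qed

lemma rim_hook_iff_border_strip:
  assumes lam: "is_partition lam" and nu: "is_partition nu"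
  shows "rim_hook lam nu k \<longleftrightarrow> (\<exists>a b. border_strip lam nu a b \<and> bead nu b = bead lam a - int k)"
proof
  assume hook: "rim_hook lam nu k"
  then obtain a b where strip: "border_strip lam nu a b"
    using connected_skew_border_strip[OF lam nu] by (auto simp: rim_hook_def)
  moreover have "bead nu b = bead lam a - int k"
    using border_strip_sizes[OF lam nu strip] hook by (auto simp: rim_hook_def)
  ultimately show "\<exists>a b. border_strip lam nu a b \<and> bead nu b = bead lam a - int k" by blast
next
  assume "\<exists>a b. border_strip lam nu a b \<and> bead nu b = bead lam a - int k"
  then obtain a b where strip: "border_strip lam nu a b" "bead nu b = bead lam a - int k" by blast
  then have "part_size lam - part_size nu = k"
    using border_strip_sizes[OF lam nu strip(1)] by linarith
  with strip show "rim_hook lam nu k"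
    using lam nu border_strip_sizes(1)[OF lam nu] border_strip_connected[OF lam nu]
      border_strip_no_2x2[OF lam]
    by (auto simp: rim_hook_def)
qed

text \<open>The row whose bead was lowered can be read off from nu; this later indexes the rim hooks
  of a given size by rows.\<close>

lemma border_strip_first_row:
  assumes "is_partition lam" "border_strip lam nu a b"
  shows "(LEAST i. row nu i \<noteq> row lam i) = a"
proof (rule Least_equality)
  have "a \<in> {a..b}" using assms(2) by (simp add: border_strip_def)
  then show "row nu a \<noteq> row lam a" using border_strip_row_less_iff[OF assms, of a] by simp
  fix i assume "row nu i \<noteq> row lam i"
  then show "a \<le> i" using assms(2) by (auto simp: border_strip_def not_less[symmetric])
qed

text \<open>The insertion position is forced by order: if b < b', then
  \<open>bead lam (Suc b)\<close> would lie below the inserted value in nu and above it in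
  nu'.\<close>

lemma border_strip_unique:
  assumes lam: "is_partition lam" and nu: "is_partition nu" "is_partition nu'"
    and strip: "border_strip lam nu a b" "border_strip lam nu' a b'"
    and eq: "bead nu b = bead nu' b'"
  shows "nu = nu'"
proof -
  have aux: "\<not> b < b'"
    if "is_partition nu" "is_partition nu'" "border_strip lam nu a b" "border_strip lam nu' a b'"
      "bead nu b = bead nu' b'" for nu nu' b b'
  proof
    assume "b < b'"
    have "bead nu = slide (bead lam) a b (bead nu b)" "bead nu' = slide (bead lam) a b' (bead nu' b')" "a \<le> b"
      using border_strip_iff_bead[OF lam] that by blast+
    then have "bead nu (Suc b) = bead lam (Suc b)" "bead nu' b = bead lam (Suc b)"
      using \<open>b < b'\<close> by (metis slide_def Suc_n_not_n less_Suc_eq not_less_eq)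
         (metis \<open>b < b'\<close> \<open>a \<le> b\<close> \<open>bead nu' = _\<close> slide_def)
    moreover have "bead nu (Suc b) < bead nu b" "bead nu' b' < bead nu' b"
      using bead_strict_antimono that(1,2) \<open>b < b'\<close> by auto
    ultimately show False using that(5) by simp
  qed
  have "b = b'"
    using aux[OF nu strip eq] aux[OF nu(2,1) strip(2,1) eq[symmetric]] by simp
  moreover have "bead nu = slide (bead lam) a b (bead nu b)" "bead nu' = slide (bead lam) a b' (bead nu' b')"
    using border_strip_iff_bead[OF lam] nu strip by blast+
  ultimately show ?thesis using eq bead_inject[OF nu] by simp
qed

text \<open>Every bead of lam except bead a survives as a bead of nu at a position other than b, and
  beads of nu are distinct; bead a itself is larger than the inserted value.\<close>

lemma border_strip_bead_not_in:
  assumes lam: "is_partition lam" and nu: "is_partition nu" and strip: "border_strip lam nu a b"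
  shows "bead nu b \<noteq> bead lam i"
proof
  assume eq: "bead nu b = bead lam i"
  have slide: "bead nu = slide (bead lam) a b (bead nu b)" "a \<le> b" "bead nu b < bead lam b"
    using border_strip_iff_bead[OF lam nu] strip by blast+
  consider "i < a \<or> b < i" | "a < i" "i \<le> b" | "i = a" by linarith
  then show False
  proof cases
    case 1
    then have "bead nu i = bead lam i" using strip by (auto simp: bead_def border_strip_def)
    then have "b = i" using eq bead_eq_iff[OF nu, of b i] by simp
    then show False using 1 slide(2) by simp
  next
    case 2
    then obtain i' where i': "i = Suc i'" by (cases i) auto
    then have "Suc (row nu i') = row lam i" using 2 strip by (simp add: border_strip_def)
    then have "bead nu i' = bead lam i" using i' by (simp add: bead_def)
    then show False using eq bead_eq_iff[OF nu, of b i'] 2 i' by simp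
  next
    case 3
    have "bead lam b \<le> bead lam a"
      using bead_strict_antimono[OF lam, of a b] slide(2) by (cases "a = b") auto
    then show False using slide(3) eq 3 by simp
  qed
qed

text \<open>The value v is inserted after the last bead exceeding it. The sequence stays strictly
  decreasing, so adding i back gives weakly decreasing row lengths that end in zeros.\<close>

lemma border_strip_exists:
  assumes lam: "is_partition lam" and a: "a < length lam" and less: "v < bead lam a"
    and notin: "\<And>i. i < length lam \<Longrightarrow> v \<noteq> bead lam i" and low: "- int (length lam) < v"
  obtains nu b where "is_partition nu" "border_strip lam nu a b" "bead nu b = v"
proof -
  define r where "r = length lam"
  define u where "u = bead lam"
  define b where "b = Max {i. i < r \<and> v < u i}"
  have fin: "finite {i. i < r \<and> v < u i}" by simp
  have "a \<in> {i. i < r \<and> v < u i}" using a less by (simp add: r_def u_def)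
  then have b: "b < r" "v < u b" "a \<le> b"
    using Max_in[OF fin] Max_ge[OF fin] unfolding b_def by blast+
  have u_dec: "u (Suc i) < u i" for i
    unfolding u_def using bead_strict_antimono[OF lam] by simp
  have u_tail: "u i = - int i" if "r \<le> i" for i
    using that by (simp add: u_def bead_def r_def nth_default_def)
  have v_gt: "u (Suc b) < v"
  proof (cases "Suc b < r")
    case True
    have "\<not> v < u (Suc b)" using Max_ge[OF fin, of "Suc b"] True unfolding b_def[symmetric] by auto
    then show ?thesis using notin[of "Suc b"] True by (simp add: u_def r_def)
  next
    \<comment> \<open>Here \<open>Suc b\<close> equals r, whose bead is -r; the strict lower bound
      on v is exactly what is required.\<close>
    case False
    then show ?thesis using b(1) low u_tail[of "Suc b"] by (simp add: r_def)
  qed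
  define w where "w = slide u a b v"
  have w_dec: "w (Suc i) < w i" for i
  proof -
    \<comment> \<open>Besides the two neighbours of v, the only new adjacency is at a, where
      \<open>u a\<close> has dropped out.\<close>
    consider "Suc i < a" | "Suc i = a" "a < b" | "Suc i = a" "a = b" | "a \<le> i" "Suc i < b" | "a \<le> i" "Suc i = b"
      | "i = b" | "b < i" using b(3) by linarith
    then show ?thesis
      using b v_gt u_dec[of i] u_dec[of "Suc i"] by cases (auto simp: w_def slide_def)
  qed
  have w_tail: "w i = - int i" if "r \<le> i" for i
    using that b u_tail[of i] by (simp add: w_def slide_def)
  have w_step: "w (Suc i) + int (Suc i) \<le> w i + int i" for i
    using w_dec[of i] by simp
  have w_mono: "w j + int j \<le> w i + int i" if "i \<le> j" for i j
    using lift_Suc_antimono_le[of "\<lambda>i. w i + int i", OF w_step that] .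
  have w_nonneg: "0 \<le> w i + int i" for i
    using w_mono[of i "max i r"] w_tail[of "max i r"] by simp
  obtain nu where nu: "is_partition nu" "row nu = (\<lambda>i. nat (w i + int i))"
    using partition_with_rows[of "\<lambda>i. nat (w i + int i)" r] w_step w_tail[of r]
    by (metis add.left_inverse nat_0 nat_mono order_refl)
  have "bead nu = w"
    using w_nonneg by (auto simp: bead_def nu(2))
  moreover have "w b = v" using b by (simp add: w_def slide_def)
  ultimately show ?thesis
    using that[OF nu(1), of b] border_strip_iff_bead[OF lam nu(1), of a b] b
    by (simp add: w_def u_def)
qed

lemma finite_rim_hooks: "finite {nu. rim_hook lam nu k}"
proof -
  have "nu \<in> {xs. set xs \<subseteq> {..part_size lam} \<and> length xs \<le> length lam}" if "rim_hook lam nu k" for nu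
  proof -
    have "is_partition nu" "is_partition lam" "cells nu \<subseteq> cells lam"
      using that by (auto simp: rim_hook_def)
    moreover from this have "row nu i \<le> row lam i" for i by (simp add: cells_subset_iff)
    moreover have "row lam i \<le> part_size lam" for i
      by (auto simp: part_size_def nth_default_def member_le_sum_list)
    ultimately show ?thesis
      using length_le_of_cells_subset[of nu lam]
      by (auto simp: in_set_conv_nth nth_default_def) (metis (full_types) order_trans)
  qed
  then show ?thesis
    by (intro finite_subset[OF _ finite_lists_length_le[of "{..part_size lam}" "length lam"]]) auto
qed

text \<open>Lowering a bead by k either leaves the admissible range, or collides with another bead,
  or, after sorting, gives the beads of a partition obtained by removing a rim hook; the sign
  of the sorting permutation is given by the height.\<close>

lemma rim_hook_sum:
  fixes G :: "(nat \<Rightarrow> int) \<Rightarrow> 'b::comm_ring_1"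
  assumes lam: "is_partition lam" and k: "1 \<le> k" and r: "r = length lam"
    and swap: "\<And>w i. Suc i < r \<Longrightarrow> G (w \<circ> transpose i (Suc i)) = - G w"
    and equal: "\<And>w i j. i < r \<Longrightarrow> j < r \<Longrightarrow> i \<noteq> j \<Longrightarrow> w i = w j \<Longrightarrow> G w = 0"
    and low: "\<And>w i. i < r \<Longrightarrow> w i \<le> - int r \<Longrightarrow> G w = 0"
  shows "(\<Sum>nu | rim_hook lam nu k. (-1) ^ rim_height lam nu * G (bead nu)) =
    (\<Sum>a<r. G ((bead lam)(a := bead lam a - int k)))"
proof -
  define u where "u = bead lam"
  \<comment> \<open>The rows whose lowered bead neither collides nor leaves the range;
    \<open>pos\<close> will be a bijection from the rim hooks onto them.\<close>
  define Av where "Av = {a. a < r \<and> (\<forall>i<r. u a - int k \<noteq> u i) \<and> - int r < u a - int k}"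
  define pos where "pos nu = (LEAST i. row nu i \<noteq> row lam i)" for nu
  \<comment> \<open>Each adjacent transposition of the slide contributes one sign.\<close>
  have G_slide: "G (slide w a b v) = (-1) ^ (b - a) * G (w(a := v))" if "a \<le> b" "b < r" for w a b v
    using that
  proof (induction b rule: dec_induct)
    case (step b)
    have "G (slide w a (Suc b) v) = - G (slide w a b v)"
      unfolding slide_Suc[OF step.hyps(1)] using step.prems by (rule swap)
    then show ?case using step by (simp add: Suc_diff_le)
  qed (simp add: slide_same)
  have hook_strip: "\<exists>b. border_strip lam nu (pos nu) b \<and> bead nu b = u (pos nu) - int k \<and> is_partition nu"
    if "rim_hook lam nu k" for nu
    using that rim_hook_iff_border_strip[OF lam, of nu k] border_strip_first_row[OF lam]
    by (auto simp: pos_def u_def rim_hook_def)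
  have "(\<Sum>a<r. G (u(a := u a - int k))) = (\<Sum>a\<in>Av. G (u(a := u a - int k)))"
  proof (rule sum.mono_neutral_right)
    show "\<forall>a\<in>{..<r} - Av. G (u(a := u a - int k)) = 0"
    proof
      fix a assume a: "a \<in> {..<r} - Av"
      show "G (u(a := u a - int k)) = 0"
      proof (cases "- int r < u a - int k")
        case True
        then obtain i where i: "i < r" "u a - int k = u i" using a by (auto simp: Av_def)
        then have "i \<noteq> a" using k by auto
        then show ?thesis using a i by (intro equal[of a i]) auto
      next
        case False
        then show ?thesis using a by (intro low[of a]) auto
      qed
    qed
  qed (auto simp: Av_def)
  also have "\<dots> = (\<Sum>nu | rim_hook lam nu k. G (u(pos nu := u (pos nu) - int k)))"
  proof (rule sum.reindex_cong[of pos])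
    show "inj_on pos {nu. rim_hook lam nu k}"
    proof (rule inj_onI)
      fix nu nu' assume "nu \<in> {nu. rim_hook lam nu k}" "nu' \<in> {nu. rim_hook lam nu k}" and eq: "pos nu = pos nu'"
      then obtain b b' where "border_strip lam nu (pos nu) b" "bead nu b = u (pos nu) - int k" "is_partition nu"
         "border_strip lam nu' (pos nu') b'" "bead nu' b' = u (pos nu') - int k" "is_partition nu'"
        using hook_strip by blast
      then show "nu = nu'" using border_strip_unique[OF lam, of nu nu' "pos nu" b b'] eq by simp
    qed
    show "Av = pos ` {nu. rim_hook lam nu k}"
    proof (intro equalityI subsetI)
      fix a assume a: "a \<in> Av"
      then obtain nu b where nu: "is_partition nu" "border_strip lam nu a b" "bead nu b = u a - int k"
        using border_strip_exists[OF lam, of a "u a - int k"] k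
        by (auto simp: Av_def u_def r)
      then have "rim_hook lam nu k" "pos nu = a"
        using rim_hook_iff_border_strip[OF lam] border_strip_first_row[OF lam] by (auto simp: pos_def u_def)
      then show "a \<in> pos ` {nu. rim_hook lam nu k}" by blast
    next
      fix a assume "a \<in> pos ` {nu. rim_hook lam nu k}"
      then obtain nu b where nu: "border_strip lam nu a b" "bead nu b = u a - int k" "is_partition nu"
        using hook_strip by blast
      have "b < r" "a \<le> b"
        using border_strip_sizes(2)[OF lam nu(3,1)] nu(1) by (auto simp: r border_strip_def)
      \<comment> \<open>A bead in a row b < r is at least -b, hence strictly above -r.\<close>
      moreover have "- int b \<le> bead nu b" by (simp add: bead_def)
      ultimately show "a \<in> Av"
        using border_strip_bead_not_in[OF lam nu(3,1)] nu(2) by (auto simp: Av_def u_def)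
    qed
  qed simp
  also have "\<dots> = (\<Sum>nu | rim_hook lam nu k. (-1) ^ rim_height lam nu * G (bead nu))"
  proof (intro sum.cong refl)
    fix nu assume "nu \<in> {nu. rim_hook lam nu k}"
    then obtain b where b: "border_strip lam nu (pos nu) b" "bead nu b = u (pos nu) - int k" "is_partition nu"
      using hook_strip by blast
    have "bead nu = slide u (pos nu) b (u (pos nu) - int k)" "pos nu \<le> b"
      using border_strip_iff_bead[OF lam b(3)] b(1,2) unfolding u_def by metis+
    then have "G (bead nu) = (-1) ^ (b - pos nu) * G (u(pos nu := u (pos nu) - int k))"
      using G_slide border_strip_sizes(2)[OF lam b(3,1)] r by metis
    then show "G (u(pos nu := u (pos nu) - int k)) = (-1) ^ rim_height lam nu * G (bead nu)"
      by (simp add: rim_height_border_strip[OF lam b(1)] flip: mult.assoc power_add mult_2)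
  qed
  finally show ?thesis by (simp add: u_def)
qed

lemma card_cells: "finite (cells lam)" "card (cells lam) = part_size lam"
proof -
  have "cells lam = Sigma {..<length lam} (\<lambda>i. {..<row lam i})"
    by (auto simp: cells_def nth_default_def)
  then show "finite (cells lam)" "card (cells lam) = part_size lam"
    by (auto simp: part_size_eq_sum_rows[OF order_refl])
qed

lemma covered_by_diff:
  assumes "covered_by mu lam"
  obtains x where "x \<notin> cells mu" "cells lam = insert x (cells mu)"
proof -
  have "card (cells lam - cells mu) = 1"
    using assms by (auto simp: covered_by_def card_Diff_subset card_cells)
  then obtain x where "cells lam - cells mu = {x}" using card_1_singletonE by blast
  then show ?thesis using assms that[of x] by (auto simp: covered_by_def)
qed

text \<open>A single cell is connected and too small to contain a square, so the x term of the
  theorem is a sum over hooks of size 1.\<close>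

lemma covered_by_iff_rim_hook:
  "is_partition lam \<Longrightarrow> covered_by mu lam \<longleftrightarrow> rim_hook lam mu 1"
proof
  assume cov: "covered_by mu lam"
  then obtain x where x: "x \<notin> cells mu" "cells lam = insert x (cells mu)" by (rule covered_by_diff)
  then have "cells lam - cells mu = {x}" by auto
  with cov show "rim_hook lam mu 1"
    by (auto simp: covered_by_def rim_hook_def cells_connected_def contains_2x2_def)
qed (auto simp: covered_by_def rim_hook_def)

lemma rim_height_covered_by:
  assumes "covered_by mu lam"
  shows "rim_height lam mu = 0"
proof -
  obtain x where "x \<notin> cells mu" "cells lam = insert x (cells mu)"
    using assms by (rule covered_by_diff)
  then have "cells lam - cells mu = {x}" by auto
  then show ?thesis by (simp add: rim_height_def)
qed

section \<open>Standard Young tableaux\<close>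

lemma SYT_D:
  assumes "T \<in> SYT lam"
  shows SYT_bij: "bij_betw T (cells lam) {1..part_size lam}"
    and SYT_outside: "c \<notin> cells lam \<Longrightarrow> T c = 0"
    and SYT_row: "(i, Suc j) \<in> cells lam \<Longrightarrow> T (i, j) < T (i, Suc j)"
    and SYT_col: "(Suc i, j) \<in> cells lam \<Longrightarrow> T (i, j) < T (Suc i, j)"
proof -
  show "bij_betw T (cells lam) {1..part_size lam}" "c \<notin> cells lam \<Longrightarrow> T c = 0"
    using assms unfolding SYT_def by blast+
  show "(i, Suc j) \<in> cells lam \<Longrightarrow> T (i, j) < T (i, Suc j)"
    "(Suc i, j) \<in> cells lam \<Longrightarrow> T (i, j) < T (Suc i, j)"
    using assms by (simp_all add: SYT_def)
qed

lemma finite_SYT: "finite (SYT lam)"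
proof (rule finite_subset)
  show "SYT lam \<subseteq> {T. \<forall>x. (x \<in> cells lam \<longrightarrow> T x \<in> {1..part_size lam}) \<and> (x \<notin> cells lam \<longrightarrow> T x = 0)}"
    by (auto simp: SYT_def bij_betw_def)
  show "finite {T. \<forall>x. (x \<in> cells lam \<longrightarrow> T x \<in> {1..part_size lam}) \<and> (x \<notin> cells lam \<longrightarrow> T x = 0)}"
    by (rule finite_set_of_finite_funs) (simp_all add: card_cells)
qed

lemma SYT_le:
  assumes "T \<in> SYT lam"
  shows "T c \<le> part_size lam"
proof (cases "c \<in> cells lam")
  case True
  then have "T c \<in> {1..part_size lam}" using assms by (auto simp: SYT_def bij_betw_def)
  then show ?thesis by simp
qed (simp add: SYT_outside[OF assms])

lemma cells_inject:
  assumes "is_partition lam" "is_partition mu" "cells lam = cells mu"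
  shows "lam = mu"
  using assms(1,2)
proof (rule partition_eqI)
  fix i
  show "row lam i = row mu i"
    using assms(3) cells_subset_iff by (metis order_antisym order_refl)
qed

lemma cells_left_up_closed:
  assumes "is_partition lam" "(i, j) \<in> cells lam" "i' \<le> i" "j' \<le> j"
  shows "(i', j') \<in> cells lam"
  using assms row_antimono[OF assms(1,3)] by (simp add: mem_cells_iff)

lemma SYT_extend:
  assumes cov: "covered_by mu lam" and x: "x \<notin> cells mu" "cells lam = insert x (cells mu)"
    and T: "T \<in> SYT mu"
  shows "T(x := part_size lam) \<in> SYT lam"
proof -
  let ?T = "T(x := part_size lam)"
  have size: "part_size lam = Suc (part_size mu)" and mu: "is_partition mu"
    using cov by (auto simp: covered_by_def)
  have lt: "T c < part_size lam" for c using SYT_le[OF T, of c] size by simp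
  have "bij_betw T (cells mu) {1..part_size mu}" using T by (simp add: SYT_def)
  then have "bij_betw ?T (cells mu) {1..part_size mu}"
    by (subst bij_betw_cong[of _ _ T]) (use x in auto)
  then have "bij_betw ?T (insert x (cells mu)) (insert (part_size lam) {1..part_size mu})"
    using x(1) size notIn_Un_bij_betw3[of x "cells mu" ?T "{1..part_size mu}"] by simp
  moreover have "insert (part_size lam) {1..part_size mu} = {1..part_size lam}"
    using size by auto
  ultimately have bij: "bij_betw ?T (cells lam) {1..part_size lam}" using x(2) by simp
  have zero: "?T c = 0" if "c \<notin> cells lam" for c
    using that x(2) by (simp add: SYT_outside[OF T])
  \<comment> \<open>Either d is the new cell, which holds the maximum, or d lies in mu; then so does
    its left or upper neighbour c, and both keep their old entries.\<close>
  have less: "?T c < ?T d"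
    if "d \<in> cells lam" "d \<in> cells mu \<Longrightarrow> c \<in> cells mu \<and> T c < T d" "c \<noteq> d" for c d
    using that x lt[of c] by (cases "d = x") auto
  have "?T (i, j) < ?T (i, j + 1)" if "(i, j + 1) \<in> cells lam" for i j
    using that SYT_row[OF T, of i j] cells_left_up_closed[OF mu, of i "Suc j" i j]
    by (intro less) simp_all
  moreover have "?T (i, j) < ?T (i + 1, j)" if "(i + 1, j) \<in> cells lam" for i j
    using that SYT_col[OF T, of i j] cells_left_up_closed[OF mu, of "Suc i" j i j]
    by (intro less) simp_all
  ultimately show ?thesis
    unfolding SYT_def using bij zero by blast
qed

text \<open>The largest entry has no cell to its right or below it, so it occupies a corner, and
  shortening its row by one gives the rows of mu.\<close>

lemma SYT_remove_max:
  assumes lam: "is_partition lam" and T: "T \<in> SYT lam" and size: "1 \<le> part_size lam"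
  obtains mu x T' where "covered_by mu lam" "x \<notin> cells mu" "cells lam = insert x (cells mu)"
    "T' \<in> SYT mu" "T = T'(x := part_size lam)"
proof -
  have bij: "bij_betw T (cells lam) {1..part_size lam}" using T by (simp add: SYT_def)
  then have "part_size lam \<in> T ` cells lam" using size by (simp add: bij_betw_def)
  then obtain x where x: "x \<in> cells lam" "T x = part_size lam" by auto
  obtain i j where ij: "x = (i, j)" by (cases x)
  have "(i, Suc j) \<notin> cells lam" "(Suc i, j) \<notin> cells lam"
    using SYT_row[OF T, of i j] SYT_col[OF T, of i j] SYT_le[OF T, of "(i, Suc j)"]
      SYT_le[OF T, of "(Suc i, j)"] x ij by auto
  then have row_i: "row lam i = Suc j" "row lam (Suc i) \<le> j"
    using x ij by (auto simp: mem_cells_iff)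
  define g where "g = (row lam)(i := j)"
  have "g (Suc l) \<le> g l" for l
    using row_antimono[OF lam, of l "Suc l"] row_i by (auto simp: g_def)
  \<comment> \<open>This index lies past the modified row i as well as past the list.\<close>
  moreover have "g (max (Suc i) (length lam)) = 0" by (simp add: g_def nth_default_def)
  ultimately obtain mu where mu: "is_partition mu" "row mu = g"
    using partition_with_rows by blast
  have "c \<in> cells mu \<longleftrightarrow> c \<in> cells lam \<and> c \<noteq> x" for c
    using row_i by (cases c) (auto simp: mem_cells_iff mu(2) g_def ij)
  then have cells_mu: "cells mu = cells lam - {x}" by auto
  then have x_mu: "x \<notin> cells mu" "cells lam = insert x (cells mu)" using x(1) by auto
  have size_mu: "Suc (part_size mu) = part_size lam"
    using cells_mu x(1) card_cells[of lam] card_cells[of mu] by (metis card.remove)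
  have cov: "covered_by mu lam"
    unfolding covered_by_def using lam mu(1) cells_mu size_mu by auto
  \<comment> \<open>\<open>SYT\<close> requires the value 0 off the shape, and x no longer belongs
    to it.\<close>
  define T' where "T' = T(x := 0)"
  have "bij_betw T (cells mu) ({1..part_size lam} - {part_size lam})"
    unfolding cells_mu using bij_betw_DiffI[OF bij, of "{x}" "{part_size lam}"] x size
    by (simp add: bij_betw_def)
  moreover have "{1..part_size lam} - {part_size lam} = {1..part_size mu}" using size_mu by auto
  ultimately have "bij_betw T (cells mu) {1..part_size mu}" by simp
  then have "bij_betw T' (cells mu) {1..part_size mu}"
    by (subst bij_betw_cong[of _ _ T]) (use x_mu in \<open>auto simp: T'_def\<close>)
  moreover have "T' c = 0" if "c \<notin> cells mu" for c
    using that SYT_outside[OF T] cells_mu by (cases "c = x") (auto simp: T'_def)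
  moreover have "T' (a, b) < T' (a, b + 1)" if "(a, b + 1) \<in> cells mu" for a b
    using that SYT_row[OF T, of a b] cells_mu by (simp add: T'_def)
  moreover have "T' (a, b) < T' (a + 1, b)" if "(a + 1, b) \<in> cells mu" for a b
    using that SYT_col[OF T, of a b] cells_mu by (simp add: T'_def)
  ultimately have "T' \<in> SYT mu" by (simp add: SYT_def)
  moreover have "T = T'(x := part_size lam)" using x(2) by (auto simp: T'_def)
  ultimately show ?thesis using that[OF cov x_mu] by blast
qed

lemma finite_covered_by:
  assumes "is_partition lam"
  shows "finite {mu. covered_by mu lam}"
  using finite_rim_hooks[of lam 1] covered_by_iff_rim_hook[OF assms] by simp

text \<open>The branching rule: deleting the largest entry sorts the tableaux by the corner it
  occupied, and this corner determines mu.\<close>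

lemma num_SYT_recursion:
  assumes lam: "is_partition lam" and size: "1 \<le> part_size lam"
  shows "num_SYT lam = (\<Sum>mu | covered_by mu lam. num_SYT mu)"
proof -
  define n where "n = part_size lam"
  define x where "x mu = (THE x. x \<notin> cells mu \<and> cells lam = insert x (cells mu))" for mu
  have x_eq: "x mu = y" if "y \<notin> cells mu" "cells lam = insert y (cells mu)" for mu y
    unfolding x_def by (rule the_equality) (use that in auto)
  have x: "x mu \<notin> cells mu" "cells lam = insert (x mu) (cells mu)" if "covered_by mu lam" for mu
    using covered_by_diff[OF that] x_eq by metis+
  define ext where "ext mu T = T(x mu := n)" for mu and T :: "nat \<times> nat \<Rightarrow> nat"
  have "SYT lam = (\<Union>mu\<in>{mu. covered_by mu lam}. ext mu ` SYT mu)"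
  proof (intro equalityI subsetI)
    fix T assume "T \<in> SYT lam"
    then obtain mu y T' where "covered_by mu lam" "y \<notin> cells mu" "cells lam = insert y (cells mu)"
      "T' \<in> SYT mu" "T = T'(y := part_size lam)"
      using SYT_remove_max[OF lam _ size] by metis
    then show "T \<in> (\<Union>mu\<in>{mu. covered_by mu lam}. ext mu ` SYT mu)"
      using x_eq[of y mu] by (auto simp: ext_def n_def)
  next
    fix T assume "T \<in> (\<Union>mu\<in>{mu. covered_by mu lam}. ext mu ` SYT mu)"
    then obtain mu T' where "covered_by mu lam" "T' \<in> SYT mu" "T = ext mu T'" by auto
    then show "T \<in> SYT lam"
      using SYT_extend[of mu lam "x mu" T'] x by (simp add: ext_def n_def)
  qed
  then have "num_SYT lam = card (\<Union>mu\<in>{mu. covered_by mu lam}. ext mu ` SYT mu)"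
    by (simp add: num_SYT_def)
  also have "\<dots> = (\<Sum>mu | covered_by mu lam. card (ext mu ` SYT mu))"
  proof (rule card_UN_disjoint)
    show "\<forall>mu\<in>{mu. covered_by mu lam}. \<forall>mu'\<in>{mu. covered_by mu lam}.
        mu \<noteq> mu' \<longrightarrow> ext mu ` SYT mu \<inter> ext mu' ` SYT mu' = {}"
    proof (intro ballI impI equals0I)
      fix mu mu' T
      assume cov: "mu \<in> {mu. covered_by mu lam}" "mu' \<in> {mu. covered_by mu lam}" and ne: "mu \<noteq> mu'"
        and "T \<in> ext mu ` SYT mu \<inter> ext mu' ` SYT mu'"
      then obtain T1 T2 where T: "T1 \<in> SYT mu" "T = ext mu T1" "T2 \<in> SYT mu'" "T = ext mu' T2" by auto
      \<comment> \<open>Entries of T2 are at most n - 1, so T can take the value n at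
        \<open>x mu\<close> only if this is also the cell added to mu'.\<close>
      have "T2 (x mu) < n"
        using SYT_le[OF T(3), of "x mu"] cov by (auto simp: n_def covered_by_def)
      moreover have "T (x mu) = n" using T(2) by (simp add: ext_def)
      ultimately have "x mu = x mu'" using T(4) by (auto simp: ext_def split: if_splits)
      then have "cells mu = cells mu'" using x cov by (metis Diff_insert_absorb mem_Collect_eq)
      then show False using ne cells_inject cov by (auto simp: covered_by_def)
    qed
  qed (use finite_covered_by[OF lam] finite_SYT in auto)
  also have "\<dots> = (\<Sum>mu | covered_by mu lam. num_SYT mu)"
  proof (intro sum.cong refl)
    fix mu assume cov: "mu \<in> {mu. covered_by mu lam}"
    have "inj_on (ext mu) (SYT mu)"
    proof (rule inj_onI)
      fix T1 T2 assume T: "T1 \<in> SYT mu" "T2 \<in> SYT mu" "ext mu T1 = ext mu T2"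
      have "T1 (x mu) = 0" "T2 (x mu) = 0" using SYT_outside[OF T(1)] SYT_outside[OF T(2)] x(1) cov by auto
      then show "T1 = T2" using T(3) unfolding ext_def by (metis fun_upd_triv fun_upd_upd)
    qed
    then show "card (ext mu ` SYT mu) = num_SYT mu" by (simp add: card_image num_SYT_def)
  qed
  finally show ?thesis .
qed

lemma num_SYT_Nil: "num_SYT [] = 1"
proof -
  have "SYT [] = {\<lambda>_. 0}"
    by (auto simp: SYT_def cells_def part_size_def bij_betw_def)
  then show ?thesis by (simp add: num_SYT_def)
qed

section \<open>Jacobi--Trudi determinants\<close>

text \<open>For the beads of a partition this is the Jacobi--Trudi determinant of the
  entries h (lam_i - i + j).\<close>

definition jacobi_trudi :: "(int \<Rightarrow> 'b::comm_ring_1) \<Rightarrow> nat \<Rightarrow> (nat \<Rightarrow> int) \<Rightarrow> 'b" where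
  "jacobi_trudi h r u = leibniz_det r (\<lambda>i j. h (u i + int j))"

definition schur :: "(int \<Rightarrow> 'b::comm_ring_1) \<Rightarrow> nat list \<Rightarrow> 'b" where
  "schur h lam = jacobi_trudi h (length lam) (bead lam)"

lemma schur_Nil: "schur h [] = 1"
  by (simp add: schur_def jacobi_trudi_def leibniz_det_def)

text \<open>An empty row r has bead -r, so its entries h(j - r) vanish left of the diagonal and
  equal 1 on it.\<close>

lemma jacobi_trudi_pad:
  assumes "length lam \<le> r" "\<And>z. z < 0 \<Longrightarrow> h z = 0" "h 0 = 1"
  shows "jacobi_trudi h r (bead lam) = schur h lam"
  using assms(1)
proof (induction r rule: dec_induct)
  case base
  then show ?case by (simp add: schur_def)
next
  case (step r)
  have "bead lam r = - int r" using step.hyps by (simp add: bead_def nth_default_def)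
  then have "jacobi_trudi h (Suc r) (bead lam) = jacobi_trudi h r (bead lam)"
    unfolding jacobi_trudi_def by (intro leibniz_det_last_row_unit) (simp_all add: assms)
  with step show ?case by simp
qed

text \<open>Reversing both indices turns the argument lam_i - i + j into n_j - i, the form in which
  derivatives of A_{n_j} produce it.\<close>

lemma schur_shifted_seq:
  "schur h lam = leibniz_det (length lam) (\<lambda>j i. h (int (shifted_seq lam j) - int i))"
proof -
  let ?r = "length lam"
  have "schur h lam = leibniz_det ?r (\<lambda>i j. h (bead lam (?r - 1 - i) + int (?r - 1 - j)))"
    unfolding schur_def jacobi_trudi_def
    by (rule leibniz_det_reverse[of ?r "\<lambda>i j. h (bead lam i + int j)", symmetric])
  also have "\<dots> = leibniz_det ?r (\<lambda>j i. h (int (shifted_seq lam j) - int i))"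
    by (rule leibniz_det_cong)
      (auto simp: bead_def shifted_seq_def nth_default_def of_nat_diff intro!: arg_cong[of _ _ h])
  finally show ?thesis .
qed

text \<open>The recursion of h is applied to one factor at a time in every product of the
  Leibniz expansion; the degrees of the factors add up to the same number for each permutation.\<close>

lemma jacobi_trudi_recursion:
  fixes h :: "int \<Rightarrow> 'b::comm_ring_1"
  assumes rec: "\<And>z. z \<le> int N \<Longrightarrow> of_int z * h z = (\<Sum>k=1..N. p k * h (z - int k))"
    and bound: "\<And>i j. i < r \<Longrightarrow> j < r \<Longrightarrow> u i + int j \<le> int N"
  shows "of_int (\<Sum>i<r. u i + int i) * jacobi_trudi h r u =
    (\<Sum>k=1..N. p k * (\<Sum>a<r. jacobi_trudi h r (u(a := u a - int k))))"
proof -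
  have upd: "(\<Prod>i<r. h ((u(a := v)) i + int (q i))) =
      h (v + int (q a)) * (\<Prod>i\<in>{..<r} - {a}. h (u i + int (q i)))" if "a < r" for a v and q :: "nat \<Rightarrow> nat"
  proof -
    have "(\<Prod>i<r. h ((u(a := v)) i + int (q i))) = h ((u(a := v)) a + int (q a)) *
        (\<Prod>i\<in>{..<r} - {a}. h ((u(a := v)) i + int (q i)))"
      using that by (intro prod.remove) auto
    also have "(\<Prod>i\<in>{..<r} - {a}. h ((u(a := v)) i + int (q i))) = (\<Prod>i\<in>{..<r} - {a}. h (u i + int (q i)))"
      by (rule prod.cong) auto
    finally show ?thesis by simp
  qed
  have key: "of_int (\<Sum>i<r. u i + int i) * (\<Prod>i<r. h (u i + int (q i))) =
      (\<Sum>k=1..N. p k * (\<Sum>a<r. \<Prod>i<r. h ((u(a := u a - int k)) i + int (q i))))"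
    if q: "q permutes {..<r}" for q
  proof -
    have "(\<Sum>i<r. u i + int i) = (\<Sum>i<r. u i + int (q i))"
      using sum.permute[OF q, of int] by (simp add: sum.distrib)
    then have "of_int (\<Sum>i<r. u i + int i) * (\<Prod>i<r. h (u i + int (q i))) =
        (\<Sum>a<r. of_int (u a + int (q a)) * (\<Prod>i<r. h (u i + int (q i))))"
      by (simp only: of_int_sum sum_distrib_right)
    also have "\<dots> = (\<Sum>a<r. \<Sum>k=1..N. p k * (\<Prod>i<r. h ((u(a := u a - int k)) i + int (q i))))"
    proof (intro sum.cong refl)
      fix a assume a: "a \<in> {..<r}"
      then have "q a < r" using permutes_in_image[OF q, of a] by simp
      let ?z = "u a + int (q a)"
      let ?P = "\<Prod>i\<in>{..<r} - {a}. h (u i + int (q i))"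
      have "of_int ?z * (\<Prod>i<r. h (u i + int (q i))) = (of_int ?z * h ?z) * ?P"
        using a prod.remove[of "{..<r}" a "\<lambda>i. h (u i + int (q i))"] by (simp add: mult.assoc)
      also have "of_int ?z * h ?z = (\<Sum>k=1..N. p k * h (?z - int k))"
        by (rule rec, rule bound) (use a \<open>q a < r\<close> in auto)
      also have "(\<Sum>k=1..N. p k * h (?z - int k)) * ?P =
          (\<Sum>k=1..N. p k * (\<Prod>i<r. h ((u(a := u a - int k)) i + int (q i))))"
        unfolding sum_distrib_right
        using a by (intro sum.cong refl) (simp add: upd mult.assoc diff_add_eq del: fun_upd_apply)
      finally show "of_int ?z * (\<Prod>i<r. h (u i + int (q i))) =
          (\<Sum>k=1..N. p k * (\<Prod>i<r. h ((u(a := u a - int k)) i + int (q i))))" .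
    qed
    also have "\<dots> = (\<Sum>k=1..N. p k * (\<Sum>a<r. \<Prod>i<r. h ((u(a := u a - int k)) i + int (q i))))"
      by (subst sum.swap) (simp only: sum_distrib_left)
    finally show ?thesis .
  qed
  let ?S = "{q. q permutes {..<r}}"
  have "of_int (\<Sum>i<r. u i + int i) * jacobi_trudi h r u =
      (\<Sum>q\<in>?S. of_int (sign q) * (of_int (\<Sum>i<r. u i + int i) * (\<Prod>i<r. h (u i + int (q i)))))"
    unfolding jacobi_trudi_def leibniz_det_def sum_distrib_left
    by (intro sum.cong refl) (simp only: mult_ac)
  also have "\<dots> = (\<Sum>q\<in>?S. of_int (sign q) *
      (\<Sum>k=1..N. p k * (\<Sum>a<r. \<Prod>i<r. h ((u(a := u a - int k)) i + int (q i)))))"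
    by (intro sum.cong refl) (simp only: key mem_Collect_eq)
  also have "\<dots> = (\<Sum>q\<in>?S. \<Sum>k=1..N. \<Sum>a<r. p k * (of_int (sign q) *
      (\<Prod>i<r. h ((u(a := u a - int k)) i + int (q i)))))"
    by (simp only: sum_distrib_left mult_ac)
  also have "\<dots> = (\<Sum>k=1..N. \<Sum>q\<in>?S. \<Sum>a<r. p k * (of_int (sign q) *
      (\<Prod>i<r. h ((u(a := u a - int k)) i + int (q i)))))"
    by (rule sum.swap)
  also have "\<dots> = (\<Sum>k=1..N. \<Sum>a<r. \<Sum>q\<in>?S. p k * (of_int (sign q) *
      (\<Prod>i<r. h ((u(a := u a - int k)) i + int (q i)))))"
    by (intro sum.cong refl sum.swap)
  also have "\<dots> = (\<Sum>k=1..N. p k * (\<Sum>a<r. jacobi_trudi h r (u(a := u a - int k))))"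
    unfolding jacobi_trudi_def leibniz_det_def by (simp only: sum_distrib_left)
  finally show ?thesis .
qed

text \<open>In symmetric functions this is n s_lam = sum_k p_k (p_k^perp s_lam), with the adjoint
  p_k^perp given by the Murnaghan-Nakayama rule. The assumption \<open>rec\<close> is Newton's
  identity.\<close>

lemma schur_recursion:
  fixes h :: "int \<Rightarrow> 'b::{idom, ring_char_0}"
  assumes lam: "is_partition lam"
    and neg: "\<And>z. z < 0 \<Longrightarrow> h z = 0" and h0: "h 0 = 1"
    and rec: "\<And>m. of_nat m * h (int m) = (\<Sum>k=1..m. p k * h (int m - int k))"
  shows "of_nat (part_size lam) * schur h lam =
    (\<Sum>k=1..part_size lam. p k * (\<Sum>nu | rim_hook lam nu k. (-1) ^ rim_height lam nu * schur h nu))"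
proof -
  \<comment> \<open>N bounds every argument \<open>bead lam i + int j\<close>, so one range of k
    serves all entries; the surplus terms vanish because h is zero at negative integers.\<close>
  define r n N where "r = length lam" and "n = part_size lam" and "N = n + r"
  have rec': "of_int z * h z = (\<Sum>k=1..N. p k * h (z - int k))" if "z \<le> int N" for z
  proof (cases "z < 0")
    case True
    then show ?thesis by (simp add: neg)
  next
    case False
    then obtain m where m: "z = int m" by (metis not_less zero_le_imp_eq_int)
    have "(\<Sum>k=1..N. p k * h (z - int k)) = (\<Sum>k=1..m. p k * h (z - int k))"
      using that m by (intro sum.mono_neutral_right) (auto simp: neg)
    then show ?thesis using rec[of m] m by simp
  qed
  have size: "n = (\<Sum>i<r. row lam i)" using part_size_eq_sum_rows[of lam r] by (simp add: n_def r_def)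
  have "bead lam i + int j \<le> int N" if "i < r" "j < r" for i j
  proof -
    have "row lam i \<le> n" unfolding size using that by (intro member_le_sum) auto
    then show ?thesis using that by (simp add: N_def bead_def)
  qed
  then have "of_int (\<Sum>i<r. bead lam i + int i) * jacobi_trudi h r (bead lam) =
      (\<Sum>k=1..N. p k * (\<Sum>a<r. jacobi_trudi h r ((bead lam)(a := bead lam a - int k))))"
    by (intro jacobi_trudi_recursion rec')
  moreover have "(\<Sum>i<r. bead lam i + int i) = int n" by (simp add: bead_def size)
  ultimately have "of_nat n * schur h lam =
      (\<Sum>k=1..N. p k * (\<Sum>a<r. jacobi_trudi h r ((bead lam)(a := bead lam a - int k))))"
    by (simp only: schur_def r_def of_int_of_nat_eq)
  also have "\<dots> = (\<Sum>k=1..N. p k * (\<Sum>nu | rim_hook lam nu k. (-1) ^ rim_height lam nu * schur h nu))"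
  proof (intro sum.cong refl)
    fix k assume "k \<in> {1..N}"
    then have k: "1 \<le> k" by simp
    have "(\<Sum>a<r. jacobi_trudi h r ((bead lam)(a := bead lam a - int k))) =
        (\<Sum>nu | rim_hook lam nu k. (-1) ^ rim_height lam nu * jacobi_trudi h r (bead nu))"
    proof (rule rim_hook_sum[OF lam k r_def, symmetric])
      show "jacobi_trudi h r (w \<circ> transpose i (Suc i)) = - jacobi_trudi h r w" if "Suc i < r" for w i
        using leibniz_det_swap_rows[of i r "Suc i" "\<lambda>i j. h (w i + int j)"] that
        by (simp add: jacobi_trudi_def)
      show "jacobi_trudi h r w = 0" if "i < r" "j < r" "i \<noteq> j" "w i = w j" for w i j
        unfolding jacobi_trudi_def using that by (intro leibniz_det_identical_rows[of i r j]) auto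
      show "jacobi_trudi h r w = 0" if "i < r" "w i \<le> - int r" for w i
        unfolding jacobi_trudi_def using that by (intro leibniz_det_zero_row[of i r]) (auto intro!: neg)
    qed
    also have "\<dots> = (\<Sum>nu | rim_hook lam nu k. (-1) ^ rim_height lam nu * schur h nu)"
    proof (intro sum.cong refl)
      fix nu assume "nu \<in> {nu. rim_hook lam nu k}"
      then have "length nu \<le> r"
        using length_le_of_cells_subset lam by (auto simp: rim_hook_def r_def)
      then show "(-1) ^ rim_height lam nu * jacobi_trudi h r (bead nu) = (-1) ^ rim_height lam nu * schur h nu"
        using jacobi_trudi_pad[of nu r h] neg h0 by simp
    qed
    finally show "p k * (\<Sum>a<r. jacobi_trudi h r ((bead lam)(a := bead lam a - int k))) =
        p k * (\<Sum>nu | rim_hook lam nu k. (-1) ^ rim_height lam nu * schur h nu)" by simp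
  qed
  \<comment> \<open>A hook cannot have more cells than lam.\<close>
  also have "\<dots> = (\<Sum>k=1..n. p k * (\<Sum>nu | rim_hook lam nu k. (-1) ^ rim_height lam nu * schur h nu))"
  proof (rule sum.mono_neutral_right)
    show "\<forall>k\<in>{1..N} - {1..n}. p k * (\<Sum>nu | rim_hook lam nu k. (-1) ^ rim_height lam nu * schur h nu) = 0"
    proof
      fix k assume "k \<in> {1..N} - {1..n}"
      then have "{nu. rim_hook lam nu k} = {}" by (auto simp: rim_hook_def n_def)
      then show "p k * (\<Sum>nu | rim_hook lam nu k. (-1) ^ rim_height lam nu * schur h nu) = 0" by simp
    qed
  qed (auto simp: N_def)
  finally show ?thesis by (simp add: n_def)
qed

section \<open>The exponential specialisation and the number of tableaux\<close>

definition inv_fact :: "int \<Rightarrow> 'a::field_char_0" where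
  "inv_fact z = (if z < 0 then 0 else 1 / fact (nat z))"

lemma inv_fact_rec:
  "of_nat m * inv_fact (int m) = (\<Sum>k=1..m. of_bool (k = 1) * inv_fact (int m - int k) :: 'a::field_char_0)"
proof (cases m)
  case (Suc l)
  have "(\<Sum>k=1..m. of_bool (k = 1) * inv_fact (int m - int k) :: 'a) = (\<Sum>k\<in>{1}. inv_fact (int m - int k))"
    by (rule sum.mono_neutral_cong_right) (use Suc in auto)
  also have "\<dots> = inv_fact (int l)" using Suc by simp
  also have "\<dots> = of_nat m * inv_fact (int m)"
    using Suc by (simp add: inv_fact_def nat_add_distrib del: of_nat_Suc)
  finally show ?thesis by simp
qed simp

text \<open>The factor n in the recursion is what turns (n - 1)! into n! in the induction on the
  size.\<close>

lemma num_SYT_eq_schur: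
  assumes "is_partition lam"
  shows "of_nat (num_SYT lam) = fact (part_size lam) * schur (inv_fact :: int \<Rightarrow> 'a::field_char_0) lam"
  using assms
proof (induction "part_size lam" arbitrary: lam rule: less_induct)
  case less
  let ?h = "inv_fact :: int \<Rightarrow> 'a"
  define n where "n = part_size lam"
  show ?case
  proof (cases "n = 0")
    case True
    then have "lam = []" using less.prems by (cases lam) (auto simp: n_def part_size_def is_partition_def)
    then show ?thesis by (simp add: num_SYT_Nil schur_Nil part_size_def)
  next
    case False
    have "of_nat n * schur ?h lam =
        (\<Sum>k=1..n. of_bool (k = 1) * (\<Sum>nu | rim_hook lam nu k. (-1) ^ rim_height lam nu * schur ?h nu))"
      unfolding n_def by (rule schur_recursion[OF less.prems _ _ inv_fact_rec]) (simp_all add: inv_fact_def)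
    also have "\<dots> = (\<Sum>k\<in>{1}. \<Sum>nu | rim_hook lam nu k. (-1) ^ rim_height lam nu * schur ?h nu)"
      by (rule sum.mono_neutral_cong_right) (use False in auto)
    also have "\<dots> = (\<Sum>mu | covered_by mu lam. schur ?h mu)"
      using covered_by_iff_rim_hook[OF less.prems] rim_height_covered_by by simp
    finally have rec: "of_nat n * schur ?h lam = (\<Sum>mu | covered_by mu lam. schur ?h mu)" .
    have "of_nat (num_SYT lam) = (\<Sum>mu | covered_by mu lam. of_nat (num_SYT mu) :: 'a)"
      using num_SYT_recursion[OF less.prems] False by (simp add: n_def)
    also have "\<dots> = (\<Sum>mu | covered_by mu lam. fact (n - 1) * schur ?h mu)"
    proof (intro sum.cong refl)
      fix mu assume "mu \<in> {mu. covered_by mu lam}"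
      then have "is_partition mu" "part_size mu < part_size lam" "part_size mu = n - 1"
        by (auto simp: covered_by_def n_def)
      with less.hyps[of mu] show "of_nat (num_SYT mu) = fact (n - 1) * schur ?h mu" by simp
    qed
    also have "\<dots> = fact (n - 1) * (of_nat n * schur ?h lam)"
      by (simp add: rec sum_distrib_left)
    also have "\<dots> = fact n * schur ?h lam"
      using False fact_reduce[of n, where 'a = 'a] by (simp add: mult_ac)
    finally show ?thesis by (simp add: n_def)
  qed
qed

lemma shifted_seq_bead:
  assumes "i < length lam"
  shows "int (shifted_seq lam i) = bead lam (length lam - 1 - i) + int (length lam - 1)"
  using assms by (simp add: shifted_seq_def bead_def nth_default_def of_nat_diff)

lemma inj_on_shifted_seq:
  assumes "is_partition lam"
  shows "inj_on (shifted_seq lam) {..<length lam}"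
proof (rule inj_onI)
  fix i j assume ij: "i \<in> {..<length lam}" "j \<in> {..<length lam}" "shifted_seq lam i = shifted_seq lam j"
  then have "bead lam (length lam - 1 - i) = bead lam (length lam - 1 - j)"
    using shifted_seq_bead[of i lam] shifted_seq_bead[of j lam] by simp
  then have "length lam - 1 - i = length lam - 1 - j" using bead_eq_iff[OF assms] by blast
  with ij show "i = j" by auto
qed

lemma vandermonde_nonzero:
  assumes "is_partition lam"
  shows "vandermonde (length lam) (shifted_seq lam) \<noteq> 0"
proof
  assume "vandermonde (length lam) (shifted_seq lam) = 0"
  then obtain i j where "j < length lam" "i < j" "shifted_seq lam j = shifted_seq lam i"
    by (auto simp: vandermonde_def)
  then show False using inj_on_shifted_seq[OF assms] by (auto dest!: inj_onD)
qed

text \<open>This is n!/(n - i)!. For i > n both sides vanish, the right one through the factor n -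
  n.\<close>

lemma fact_inv_fact: "fact n * inv_fact (int n - int i) = falling (of_nat n :: 'a::field_char_0) i"
proof (induction i)
  case (Suc i)
  have "falling (of_nat n :: 'a) (Suc i) = falling (of_nat n) i * (of_nat n - of_nat i)"
    by (simp add: falling_def)
  also have "\<dots> = fact n * (inv_fact (int n - int i) * (of_nat n - of_nat i))"
    by (simp flip: Suc)
  also have "inv_fact (int n - int i) * (of_nat n - of_nat i :: 'a) = inv_fact (int n - int (Suc i))"
  proof (cases "i < n")
    case True
    then obtain d where "n = Suc (i + d)" using less_imp_Suc_add by blast
    then have eqs: "int n - int i = int (Suc d)" "(of_nat n - of_nat i :: 'a) = of_nat (Suc d)"
      "int n - int (Suc i) = int d" by simp_all
    show ?thesis unfolding inv_fact_def eqs by (simp add: nat_add_distrib del: of_nat_Suc)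
  qed (auto simp: inv_fact_def not_less)
  finally show ?case by simp
qed (simp add: falling_def inv_fact_def)

text \<open>Together with \<open>num_SYT_eq_schur\<close> this is Frobenius' formula: F_lam is n!
  times the Vandermonde product divided by the product of the n_j!.\<close>

lemma schur_inv_fact:
  assumes "is_partition lam"
  shows "(\<Prod>j<length lam. fact (shifted_seq lam j)) * schur inv_fact lam =
    (of_int (vandermonde (length lam) (shifted_seq lam)) :: 'a::field_char_0)"
proof -
  let ?n = "shifted_seq lam" and ?r = "length lam"
  have "(\<Prod>j<?r. fact (?n j)) * schur inv_fact lam =
      leibniz_det ?r (\<lambda>j i. falling (of_nat (?n j) :: 'a) i)"
    unfolding schur_shifted_seq
    by (simp add: fact_inv_fact flip: leibniz_det_scale_rows)
  also have "\<dots> = (\<Prod>j<?r. \<Prod>i<j. of_nat (?n j) - of_nat (?n i))"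
    using inj_on_shifted_seq[OF assms] by (intro vandermonde_falling) (auto simp: inj_on_def)
  also have "\<dots> = of_int (vandermonde ?r ?n)" by (simp add: vandermonde_def)
  finally show ?thesis .
qed

section \<open>Appell polynomials\<close>

definition appell_h :: "(nat \<Rightarrow> 'a::field_char_0 poly) \<Rightarrow> int \<Rightarrow> 'a poly" where
  "appell_h A z = (if z < 0 then 0 else smult (1 / fact (nat z)) (A (nat z)))"

text \<open>Dividing by m! makes differentiation a pure index shift; the zero extension keeps this
  valid at index 0, where A 0 is constant.\<close>

lemma pderiv_appell_h:
  assumes "appell A"
  shows "pderiv (appell_h A z) = appell_h A (z - 1)"
proof -
  consider "z < 0" | "z = 0" | m where "z = int (Suc m)"
    by (metis int_cases less_irrefl neg_int_cases not0_implies_Suc of_nat_0 negative_zless_0)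
  then show ?thesis
  proof cases
    case 2
    then show ?thesis using assms by (simp add: appell_h_def appell_def pderiv_smult)
  next
    case 3
    have "pderiv (A (Suc m)) = smult (of_nat (Suc m)) (A m)"
      using assms by (simp add: appell_def)
    moreover have "z - 1 = int m" "\<not> z < 0" "nat z = Suc m" using 3 by auto
    ultimately show ?thesis by (simp add: appell_h_def pderiv_smult del: of_nat_Suc)
  qed (simp add: appell_h_def)
qed

lemma higher_pderiv_appell:
  assumes "appell A"
  shows "(pderiv ^^ i) (A n) = smult (fact n) (appell_h A (int n - int i))"
proof (induction i)
  case (Suc i)
  then show ?case by (simp add: pderiv_smult pderiv_appell_h[OF assms] algebra_simps)
qed (simp add: appell_h_def)

text \<open>The Wronskian is S_lam times the product P of the n_j!, and A_lam divides it by the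
  Vandermonde product V; by Frobenius' formula F_lam P / V = n!.\<close>

lemma num_SYT_appell_schur:
  assumes A: "appell A" and lam: "is_partition lam"
  shows "smult (of_nat (num_SYT lam)) (appell_schur A lam) = smult (fact (part_size lam)) (schur (appell_h A) lam)"
proof (cases "lam = []")
  case True
  then show ?thesis by (simp add: num_SYT_Nil appell_schur_def schur_Nil part_size_def)
next
  case False
  let ?n = "shifted_seq lam" and ?r = "length lam"
  define V P where "V = (of_int (vandermonde ?r ?n) :: 'a)" and "P = (\<Prod>j<?r. fact (?n j) :: 'a)"
  have V: "V \<noteq> 0" using vandermonde_nonzero[OF lam] by (simp add: V_def)
  have "wronskian ?r (\<lambda>i. A (?n i)) = leibniz_det ?r (\<lambda>i j. [:fact (?n j):] * appell_h A (int (?n j) - int i))"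
    by (simp add: wronskian_def leibniz_det_def higher_pderiv_appell[OF A])
  also have "\<dots> = leibniz_det ?r (\<lambda>j i. [:fact (?n j):] * appell_h A (int (?n j) - int i))"
    by (rule leibniz_det_transpose[symmetric])
  also have "\<dots> = [:P:] * schur (appell_h A) lam"
    unfolding leibniz_det_scale_rows schur_shifted_seq P_def prod_const_poly ..
  finally have wr: "wronskian ?r (\<lambda>i. A (?n i)) = smult P (schur (appell_h A) lam)" by simp
  have "of_nat (num_SYT lam) * P = fact (part_size lam) * V"
    using num_SYT_eq_schur[OF lam, where 'a = 'a] schur_inv_fact[OF lam, where 'a = 'a]
    by (simp add: V_def P_def mult_ac)
  then have "of_nat (num_SYT lam) * (1 / V * P) = fact (part_size lam)"
    using V by (simp add: field_simps)
  then show ?thesis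
    using False by (simp add: appell_schur_def wr V_def)
qed

text \<open>The logarithm is encoded by exponentiating c. The identity is the coefficient of t^(m-1)
  in F' = (\<open>egf1 c\<close>)' F, where c_k t^k/k! contributes c_k/(k-1)!.\<close>

lemma appell_f_recurrence:
  fixes c :: "nat \<Rightarrow> 'a::field_char_0"
  assumes "fps_compose (fps_exp 1) (egf1 c) = F"
  shows "of_nat m * fps_nth F m = (\<Sum>k=1..m. c k / fact (k - 1) * fps_nth F (m - k))"
proof (cases m)
  case (Suc l)
  have "fps_deriv F = fps_deriv (egf1 c) * F"
    unfolding assms[symmetric] by (subst fps_compose_deriv) (simp_all add: egf1_def mult.commute)
  then have "fps_nth (fps_deriv F) l = fps_nth (fps_deriv (egf1 c) * F) l" by (simp only:)
  then have "of_nat m * fps_nth F m = (\<Sum>i=0..l. of_nat (Suc i) * fps_nth (egf1 c) (Suc i) * fps_nth F (l - i))"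
    using Suc by (simp add: fps_mult_nth)
  also have "\<dots> = (\<Sum>i=0..l. c (Suc i) / fact i * fps_nth F (l - i))"
    by (intro sum.cong refl) (simp add: egf1_def field_simps del: of_nat_Suc)
  also have "\<dots> = (\<Sum>k=Suc 0..Suc l. c k / fact (k - 1) * fps_nth F (m - k))"
    unfolding sum.shift_bounds_cl_Suc_ivl using Suc by simp
  finally show ?thesis using Suc by simp
qed simp

text \<open>Differentiating the identity for m + 1 in x gives the identity for m, so by induction
  the difference D of its two sides is constant; at x = 0 it is the recurrence for the coefficients
  of f_A. No series in two variables is involved.\<close>

lemma appell_h_recurrence:
  fixes A :: "nat \<Rightarrow> 'a::field_char_0 poly"
  assumes A: "appell A" and c: "fps_compose (fps_exp 1) (egf1 c) = appell_f A"
  shows "of_nat m * appell_h A (int m) = [:0, 1:] * appell_h A (int m - 1) +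
    (\<Sum>k=1..m. [:c k / fact (k - 1):] * appell_h A (int m - int k))"
proof (induction m)
  case 0
  then show ?case by (simp add: appell_h_def)
next
  case (Suc m)
  let ?h = "appell_h A" and ?X = "[:0, 1 :: 'a:]"
  define D where "D = of_nat (Suc m) * ?h (int (Suc m)) - ?X * ?h (int m) -
    (\<Sum>k=1..Suc m. [:c k / fact (k - 1):] * ?h (int (Suc m) - int k))"
  have dh: "pderiv (?h (int (Suc m) - int k)) = ?h (int m - int k)" for k
    by (simp add: pderiv_appell_h[OF A] algebra_simps)
  have "pderiv D = of_nat (Suc m) * ?h (int m) - (?h (int m) + ?X * ?h (int m - 1)) -
      (\<Sum>k=1..Suc m. [:c k / fact (k - 1):] * ?h (int m - int k))"
  proof -
    have "pderiv (of_nat (Suc m) * ?h (int (Suc m))) = of_nat (Suc m) * ?h (int m)"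
      using dh[of 0] by (simp add: pderiv_smult of_nat_poly del: of_nat_Suc)
    moreover have "pderiv (?X * ?h (int m)) = ?h (int m) + ?X * ?h (int m - 1)"
      by (simp add: pderiv_mult pderiv_appell_h[OF A] pderiv_pCons)
    moreover have "pderiv (\<Sum>k=1..Suc m. [:c k / fact (k - 1):] * ?h (int (Suc m) - int k)) =
        (\<Sum>k=1..Suc m. [:c k / fact (k - 1):] * ?h (int m - int k))"
      unfolding higher_pderiv_sum[of 1, simplified] by (intro sum.cong refl) (simp only: dh mult_pCons_left pderiv_add pderiv_smult pderiv_pCons, simp)
    ultimately show ?thesis unfolding D_def pderiv_diff by simp
  qed
  \<comment> \<open>The last term has index -1 and vanishes.\<close>
  also have "(\<Sum>k=1..Suc m. [:c k / fact (k - 1):] * ?h (int m - int k)) =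
      (\<Sum>k=1..m. [:c k / fact (k - 1):] * ?h (int m - int k))"
    by (simp add: appell_h_def[of A "- 1"])
  finally have "pderiv D = 0" using Suc.IH by (simp add: algebra_simps)
  then have "degree D = 0" by (simp add: pderiv_eq_0_iff)
  moreover have "poly D 0 = 0"
  proof -
    have h0: "poly (?h (int (Suc m) - int k)) 0 = fps_nth (appell_f A) (Suc m - k)" if "k \<le> Suc m" for k
    proof -
      have eq: "int (Suc m) - int k = int (Suc m - k)" using that by (rule of_nat_diff[symmetric])
      show ?thesis unfolding eq by (simp add: appell_h_def appell_f_def)
    qed
    have "poly D 0 = of_nat (Suc m) * poly (?h (int (Suc m) - int 0)) 0 -
        (\<Sum>k=1..Suc m. c k / fact (k - 1) * poly (?h (int (Suc m) - int k)) 0)"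
      unfolding D_def by (simp add: poly_sum of_nat_poly del: of_nat_Suc sum.cl_ivl_Suc)
    also have "\<dots> = of_nat (Suc m) * fps_nth (appell_f A) (Suc m) -
        (\<Sum>k=1..Suc m. c k / fact (k - 1) * fps_nth (appell_f A) (Suc m - k))"
      by (intro arg_cong2[where f = minus] sum.cong) (simp_all only: h0 atLeastAtMost_iff, simp)
    finally show ?thesis using appell_f_recurrence[OF c, of "Suc m"] by simp
  qed
  ultimately have "D = 0" by (metis degree_eq_zeroE poly_pCons mult_zero_left add_0_right poly_0 pCons_0_0)
  then show ?case by (simp add: D_def diff_eq_eq add_ac)
qed

lemma smult_sum_right: "smult a (\<Sum>i\<in>S. f i) = (\<Sum>i\<in>S. smult a (f i))"
  by (induction S rule: infinite_finite_induct) (simp_all add: smult_add_right)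

section \<open>Assembling the recursion for F_lam A_lam\<close>

theorem theorem6p3:
  fixes A :: "nat \<Rightarrow> 'a::field_char_0 poly"
    and c :: "nat \<Rightarrow> 'a"
    and lam :: "nat list"
    and n :: nat
  assumes "appell A"
    and "fps_compose (fps_exp 1) (egf1 c) = appell_f A"
    and "is_partition lam"
    and "part_size lam = n"
    and "n \<ge> 1"
  shows "smult (of_nat (num_SYT lam)) (appell_schur A lam) =
     [:0, 1:] * (\<Sum>mu\<in>{mu. covered_by mu lam}.
                   smult (of_nat (num_SYT mu)) (appell_schur A mu))
     + (\<Sum>k = 1..n. smult (c k * of_nat ((n - 1) choose (k - 1)))
          (\<Sum>nu\<in>{nu. rim_hook lam nu k}.
             smult ((-1) ^ rim_height lam nu * of_nat (num_SYT nu)) (appell_schur A nu)))"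
proof -
  let ?h = "appell_h A" and ?X = "[:0, 1 :: 'a:]"
  \<comment> \<open>The x in p_1 is kept as a separate summand, so that the recursion splits at once
    into the x term and the sum over the c_k.\<close>
  define p where "p k = [:c k / fact (k - 1):] + of_bool (k = 1) * ?X" for k :: nat
  define R where "R k = (\<Sum>nu | rim_hook lam nu k. (-1) ^ rim_height lam nu * schur ?h nu)" for k
  have single: "(\<Sum>k=1..m. of_bool (k = 1) * ?X * g k) = of_bool (1 \<le> m) * ?X * g 1"
    for m and g :: "nat \<Rightarrow> 'a poly"
  proof (cases "1 \<le> m")
    case True
    have "(\<Sum>k=1..m. of_bool (k = 1) * ?X * g k) = (\<Sum>k\<in>{1}. ?X * g k)"
      by (rule sum.mono_neutral_cong_right) (use True in auto)
    with True show ?thesis by simp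
  qed simp
  have rec: "of_nat m * ?h (int m) = (\<Sum>k=1..m. p k * ?h (int m - int k))" for m
  proof -
    \<comment> \<open>For m = 0 the sum over k is empty, in accordance with h at -1 being 0.\<close>
    have "?X * ?h (int m - 1) = of_bool (1 \<le> m) * ?X * ?h (int m - int 1)"
      by (cases m) (simp_all add: appell_h_def)
    then show ?thesis
      unfolding appell_h_recurrence[OF assms(1,2)] p_def distrib_right sum.distrib single by simp
  qed
  have "of_nat n * schur ?h lam = (\<Sum>k=1..n. p k * R k)"
    unfolding R_def assms(4)[symmetric]
    by (rule schur_recursion[OF assms(3) _ _ rec]) (use assms(1) in \<open>simp_all add: appell_h_def appell_def\<close>)
  also have "\<dots> = ?X * R 1 + (\<Sum>k=1..n. smult (c k / fact (k - 1)) (R k))"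
    unfolding p_def distrib_right sum.distrib single using assms(5) by simp
  finally have main: "of_nat n * schur ?h lam = ?X * R 1 + (\<Sum>k=1..n. smult (c k / fact (k - 1)) (R k))" .
  have hooks: "(\<Sum>nu | rim_hook lam nu k. smult ((-1) ^ rim_height lam nu * of_nat (num_SYT nu)) (appell_schur A nu)) =
      smult (fact (n - k)) (R k)" if "k \<in> {1..n}" for k
    unfolding R_def smult_sum_right
  proof (intro sum.cong refl)
    fix nu assume "nu \<in> {nu. rim_hook lam nu k}"
    then have nu: "is_partition nu" "part_size nu = n - k"
      using assms(4) that by (auto simp: rim_hook_def)
    have "smult ((-1) ^ rim_height lam nu * of_nat (num_SYT nu)) (appell_schur A nu) =
        smult ((-1) ^ rim_height lam nu) (smult (fact (n - k)) (schur ?h nu))"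
      using num_SYT_appell_schur[OF assms(1) nu(1)] nu(2) by (metis smult_smult)
    then show "smult ((-1) ^ rim_height lam nu * of_nat (num_SYT nu)) (appell_schur A nu) =
        smult (fact (n - k)) ((-1) ^ rim_height lam nu * schur ?h nu)"
      \<comment> \<open>The sign is a scalar on the left and a polynomial on the right, hence the
        split by parity.\<close>
      by (cases "even (rim_height lam nu)") simp_all
  qed
  have "(\<Sum>mu | covered_by mu lam. smult (of_nat (num_SYT mu)) (appell_schur A mu)) = smult (fact (n - 1)) (R 1)"
    unfolding hooks[of 1, symmetric]
    using hooks[of 1] assms(5) covered_by_iff_rim_hook[OF assms(3)] rim_height_covered_by by simp
  moreover have "(\<Sum>k=1..n. smult (c k * of_nat ((n - 1) choose (k - 1)))
        (\<Sum>nu | rim_hook lam nu k. smult ((-1) ^ rim_height lam nu * of_nat (num_SYT nu)) (appell_schur A nu))) =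
      smult (fact (n - 1)) (\<Sum>k=1..n. smult (c k / fact (k - 1)) (R k))"
    unfolding smult_sum_right[where a = "fact (n - 1)"]
  proof (intro sum.cong refl)
    fix k assume k: "k \<in> {1..n}"
    \<comment> \<open>The recursion for n S_lam is multiplied by (n-1)!. A hook of size k absorbs
      (n-k)! into F_nu A_nu, and p_k carries 1/(k-1)!; what remains is the binomial
      coefficient.\<close>
    then have "(of_nat ((n - 1) choose (k - 1)) :: 'a) = fact (n - 1) / (fact (k - 1) * fact (n - k))"
      using binomial_fact[of "k - 1" "n - 1", where 'a = 'a] diff_le_mono[of k n 1] by simp
    then show "smult (c k * of_nat ((n - 1) choose (k - 1)))
        (\<Sum>nu | rim_hook lam nu k. smult ((-1) ^ rim_height lam nu * of_nat (num_SYT nu)) (appell_schur A nu)) =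
        smult (fact (n - 1)) (smult (c k / fact (k - 1)) (R k))"
      unfolding hooks[OF k] by (simp add: mult.commute)
  qed
  moreover have "smult (of_nat (num_SYT lam)) (appell_schur A lam) = smult (fact (n - 1)) (of_nat n * schur ?h lam)"
    using num_SYT_appell_schur[OF assms(1,3)] assms(4,5) fact_reduce[of n, where 'a = 'a]
    by (simp add: of_nat_poly mult.commute)
  ultimately show ?thesis
    unfolding main by (simp add: smult_add_right)
qed

end
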